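(* Let $\Gamma$ be a finitely generated group and let $(\Omega,\mu)$ be a standard Borel probability $\Gamma$-space. Let $H=\mathrm{Homeo}^+(\mathbb{S}^1)$, $\widetilde H=\mathrm{Homeo}^+_{\mathbb{Z}}(\mathbb{R})$, and let $\sigma:\Gamma\times\Omega\to H$ be a measurable cocycle. Then the following are equivalent: (1) The parametrized Euler class vanishes, that is $\mathrm{H}^2_b(\sigma)(e^b_{\mathbb{Z}})=0$ in $\mathrm{H}^2_b(\Gamma;\mathrm{L}^\infty(\Omega,\mathbb{Z}))$. (2) There exists a measurable cocycle $\widetilde\sigma:\Gamma\times\Omega\to\widetilde H$ which is a lift of $\sigma$ and $\widetilde\sigma$ admits a bounded equivariant family of points in $\mathbb{R}$. (3) There exists a $\sigma$-equivariant family of points in $\mathbb{S}^1$. (4) The cocycle $\sigma$ is semicohomologous to the trivial cocycle.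
   Context: A standard Borel probability $\Gamma$-space is a standard Borel probability space $(\Omega,\mu)$ with an essentially free, measure preserving action of $\Gamma$. $H=\mathrm{Homeo}^+(\mathbb{S}^1)$ is the group of orientation preserving homeomorphisms of $\mathbb{S}^1\cong\mathbb{R}/\mathbb{Z}$; $\widetilde H=\mathrm{Homeo}^+_{\mathbb{Z}}(\mathbb{R})$ is the group of orientation preserving homeomorphisms $f$ of $\mathbb{R}$ with $f(x+1)=f(x)+1$; both carry the Borel structure of the compact-open topology. $p:\widetilde H\to H$ is the projection and $i:\mathbb{Z}\to\widetilde H$ the inclusion as integer translations. For $L\in\{H,\widetilde H\}$, a measurable cocycle is a measurable map $\sigma:\Gamma\times\Omega\to L$ with $\sigma(\gamma_1\gamma_2,\omega)=\sigma(\gamma_1,\gamma_2\omega)\sigma(\gamma_2,\omega)$ for every $\gamma_1,\gamma_2\in\Gamma$ and almost every $\omega\in\Omega$. $\widetilde\sigma$ is a lift of $\sigma$ if $p(\widetilde\sigma(\gamma,\omega))=\sigma(\gamma,\omega)$ for every $\gamma$ and almost every $\omega$. The trivial cocycle is constantly the identity of $H$. Equivariant families: a $\sigma$-equivariant family of points is a measurable map $r:\Omega\to\mathbb{S}^1$ with $r(\gamma\omega)=\sigma(\gamma,\omega)r(\omega)$ for every $\gamma\in\Gamma$ and almost every $\omega\in\Omega$. Likewise, an equivariant family of points for $\widetilde\sigma$ is a measurable $\widetilde r:\Omega\to\mathbb{R}$ with $\widetilde r(\gamma\omega)=\widetilde\sigma(\gamma,\omega)\widetilde r(\omega)$; it is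 bounded if the essential image of $\widetilde r$ is bounded. A non-decreasing degree one map $\mathbb{S}^1\to\mathbb{S}^1$ is a (not necessarily continuous) map that weakly preserves the cyclic order of every $k$-tuple of points, for every $k\in\mathbb{N}$; equivalently, it has a lift $\mathbb{R}\to\mathbb{R}$ that is non-decreasing and commutes with integer translations (constant maps are allowed). Semicohomology: $\sigma_1$ is left semicohomologous to $\sigma_2$ (equivalently, $\sigma_2$ is right semicohomologous to $\sigma_1$) if there is a measurable map $\varphi:\mathbb{S}^1\times\Omega\to\mathbb{S}^1$ such that $\varphi(\omega):=\varphi(\cdot,\omega)$ is a non-decreasing degree one map for almost every $\omega$ and $\sigma_1(\gamma,\omega)\varphi(\omega)=\varphi(\gamma\omega)\sigma_2(\gamma,\omega)$ for every $\gamma\in\Gamma$ and almost every $\omega\in\Omega$. $\sigma_1$ and $\sigma_2$ are semicohomologous if $\sigma_1$ is both left and right semicohomologous to $\sigma_2$. Bounded cohomology: for a discrete group $G$ and a normed $G$-module $A$ with isometric action, $\mathrm{H}^n_b(G;A)$ is the cohomology of the inhomogeneous complex of bounded functions $\overline{\mathrm{C}}^n_b(G;A)=\{f:G^n\to A \text{ bounded}\}$ with coboundary $(\overline\delta f)(g_1,\dots,g_{n+1})=g_1\cdot f(g_2,\dots,g_{n+1})+\sum_{i=1}^n(-1)^if(g_1,\dots,g_ig_{i+1},\dots,g_{n+1})+(-1)^{n+1}f(g_1,\dots,g_n)$. All groups, including $H$, are regarded as discrete here. $\mathbb{Z}$ is a trivial $H$-module; $\mathrm{L}^\infty(\Omega,\mathbb{Z})$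 has the sup norm and the action $(\gamma f)(\omega)=f(\gamma^{-1}\omega)$. Bounded Euler class: let $\overline s:H\to\widetilde H$ be the section of $p$ determined by $\overline s(f)(0)\in[0,1)$. Then $\overline\varepsilon:H^2\to\mathbb{Z}$ defined by $\overline s(fg)\,i(\overline\varepsilon(f,g))=\overline s(f)\overline s(g)$ is a bounded cocycle and $e^b_{\mathbb{Z}}=[\overline\varepsilon]\in\mathrm{H}^2_b(H;\mathbb{Z})$. Parametrized Euler class: $\mathrm{H}^2_b(\sigma):\mathrm{H}^2_b(H;\mathbb{Z})\to\mathrm{H}^2_b(\Gamma;\mathrm{L}^\infty(\Omega,\mathbb{Z}))$ is induced by $\psi\mapsto\big[(\gamma,\lambda)\mapsto\big(\omega\mapsto\psi(\sigma(\gamma^{-1},\omega)^{-1},\sigma(\lambda^{-1},\gamma^{-1}\omega)^{-1})\big)\big]$, and the parametrized Euler class of $\sigma$ is $\mathrm{H}^2_b(\sigma)(e^b_{\mathbb{Z}})$. *)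

theory Defs
  imports
    "HOL-Probability.Probability"
    "HOL-Algebra.Generated_Groups"
    "HOL-Algebra.Group_Action"
    "HOL-Algebra.FiniteProduct"
begin

section \<open>The circle and its homeomorphisms\<close>

text \<open>The circle is the unit circle of the complex plane, identified with the quotient of the
  reals by the integers through \<open>t \<mapsto> exp (2 \<pi> i t)\<close>.\<close>

abbreviation circle :: "complex set" where
  "circle \<equiv> sphere 0 1"

definition circle_proj :: "real \<Rightarrow> complex" where
  "circle_proj t = cis (2 * pi * t)"

definition compact_open_topology ::
  "'a::topological_space set \<Rightarrow> ('a \<Rightarrow> 'b::topological_space) set \<Rightarrow> ('a \<Rightarrow> 'b) topology" where
  "compact_open_topology S F =
     topology_generated_by {{f \<in> F. f ` K \<subseteq> U} | K U. compact K \<and> K \<subseteq> S \<and> open U}"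

definition borel_of :: "'a topology \<Rightarrow> 'a measure" where
  "borel_of X = sigma (topspace X) {U. openin X U}"

text \<open>A homeomorphism of the circle is orientation preserving if it has a (continuous) increasing
  lift to the real line. Elements of the group are undefined off the circle.\<close>

definition homeo_circle :: "(complex \<Rightarrow> complex) monoid" where
  "homeo_circle = (BijGroup circle)\<lparr>carrier :=
     {f \<in> Bij circle. (\<exists>g. homeomorphism circle circle f g) \<and>
        (\<exists>F. continuous_on UNIV F \<and> strict_mono F \<and>
             (\<forall>t. f (circle_proj t) = circle_proj (F t)))}\<rparr>"

definition homeo_line :: "(real \<Rightarrow> real) monoid" where
  "homeo_line = (BijGroup UNIV)\<lparr>carrier :=
     {F \<in> Bij UNIV. (\<exists>E. homeomorphism UNIV UNIV F E) \<and> strict_mono F \<and>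
        (\<forall>x. F (x + 1) = F x + 1)}\<rparr>"

definition borel_homeo_circle :: "(complex \<Rightarrow> complex) measure" where
  "borel_homeo_circle = borel_of (compact_open_topology circle (carrier homeo_circle))"

definition borel_homeo_line :: "(real \<Rightarrow> real) measure" where
  "borel_homeo_line = borel_of (compact_open_topology UNIV (carrier homeo_line))"

text \<open>The projection \<open>p\<close>; the value does not depend on the chosen preimage of \<open>z\<close>.\<close>

definition homeo_proj :: "(real \<Rightarrow> real) \<Rightarrow> (complex \<Rightarrow> complex)" where
  "homeo_proj F = (\<lambda>z\<in>circle. circle_proj (F (SOME t. circle_proj t = z)))"

definition int_translation :: "int \<Rightarrow> real \<Rightarrow> real" where
  "int_translation n = (\<lambda>x. x + of_int n)"

text \<open>A tuple of points of the circle is weakly cyclically ordered if it has lifts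
  \<open>t\<^sub>1 \<le> \<dots> \<le> t\<^sub>k \<le> t\<^sub>1 + 1\<close>.\<close>

definition weakly_cyclically_ordered :: "complex list \<Rightarrow> bool" where
  "weakly_cyclically_ordered zs \<longleftrightarrow>
     (\<exists>ts. map circle_proj ts = zs \<and> sorted ts \<and> (ts \<noteq> [] \<longrightarrow> last ts \<le> hd ts + 1))"

definition nondecreasing_degree_one :: "(complex \<Rightarrow> complex) \<Rightarrow> bool" where
  "nondecreasing_degree_one f \<longleftrightarrow>
     f \<in> circle \<rightarrow> circle \<and>
     (\<forall>zs. weakly_cyclically_ordered zs \<longrightarrow> weakly_cyclically_ordered (map f zs))"


section \<open>Actions and measurable cocycles\<close>

definition finitely_generated :: "('g, 'm) monoid_scheme \<Rightarrow> bool" where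
  "finitely_generated G \<longleftrightarrow> (\<exists>S. finite S \<and> S \<subseteq> carrier G \<and> generate G S = carrier G)"

definition standard_borel :: "'w measure \<Rightarrow> bool" where
  "standard_borel M \<longleftrightarrow>
     (\<exists>X. completely_metrizable_space X \<and> second_countable X \<and>
          topspace X = space M \<and> sets M = sets (borel_of X))"

definition standard_borel_prob_space_action ::
  "('g, 'm) monoid_scheme \<Rightarrow> 'w measure \<Rightarrow> ('g \<Rightarrow> 'w \<Rightarrow> 'w) \<Rightarrow> bool" where
  "standard_borel_prob_space_action G M act \<longleftrightarrow>
     prob_space M \<and> standard_borel M \<and> group_action G (space M) act \<and>
     (\<forall>\<gamma>\<in>carrier G. act \<gamma> \<in> M \<rightarrow>\<^sub>M M \<and> distr M M (act \<gamma>) = M) \<and>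
     (AE \<omega> in M. stabilizer G act \<omega> = {\<one>\<^bsub>G\<^esub>})"

definition measurable_cocycle ::
  "('g, 'm) monoid_scheme \<Rightarrow> 'w measure \<Rightarrow> ('g \<Rightarrow> 'w \<Rightarrow> 'w) \<Rightarrow>
   ('l, 'n) monoid_scheme \<Rightarrow> 'l measure \<Rightarrow> ('g \<times> 'w \<Rightarrow> 'l) \<Rightarrow> bool" where
  "measurable_cocycle G M act L borel_L \<sigma> \<longleftrightarrow>
     \<sigma> \<in> count_space (carrier G) \<Otimes>\<^sub>M M \<rightarrow>\<^sub>M borel_L \<and>
     (\<forall>\<gamma>\<^sub>1\<in>carrier G. \<forall>\<gamma>\<^sub>2\<in>carrier G. AE \<omega> in M.
        \<sigma> (\<gamma>\<^sub>1 \<otimes>\<^bsub>G\<^esub> \<gamma>\<^sub>2, \<omega>) = \<sigma> (\<gamma>\<^sub>1, act \<gamma>\<^sub>2 \<omega>) \<otimes>\<^bsub>L\<^esub> \<sigma> (\<gamma>\<^sub>2, \<omega>))"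

abbreviation circle_cocycle where
  "circle_cocycle G M act \<equiv> measurable_cocycle G M act homeo_circle borel_homeo_circle"

abbreviation line_cocycle where
  "line_cocycle G M act \<equiv> measurable_cocycle G M act homeo_line borel_homeo_line"

definition trivial_cocycle :: "'g \<times> 'w \<Rightarrow> (complex \<Rightarrow> complex)" where
  "trivial_cocycle = (\<lambda>_. \<one>\<^bsub>homeo_circle\<^esub>)"

definition lift_of_cocycle ::
  "('g, 'm) monoid_scheme \<Rightarrow> 'w measure \<Rightarrow> ('g \<times> 'w \<Rightarrow> (real \<Rightarrow> real)) \<Rightarrow>
   ('g \<times> 'w \<Rightarrow> (complex \<Rightarrow> complex)) \<Rightarrow> bool" where
  "lift_of_cocycle G M \<sigma>' \<sigma> \<longleftrightarrow>
     (\<forall>\<gamma>\<in>carrier G. AE \<omega> in M. homeo_proj (\<sigma>' (\<gamma>, \<omega>)) = \<sigma> (\<gamma>, \<omega>))"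

definition equivariant_family ::
  "('g, 'm) monoid_scheme \<Rightarrow> 'w measure \<Rightarrow> ('g \<Rightarrow> 'w \<Rightarrow> 'w) \<Rightarrow> 'x measure \<Rightarrow>
   ('g \<times> 'w \<Rightarrow> ('x \<Rightarrow> 'x)) \<Rightarrow> ('w \<Rightarrow> 'x) \<Rightarrow> bool" where
  "equivariant_family G M act X \<sigma> r \<longleftrightarrow>
     r \<in> M \<rightarrow>\<^sub>M X \<and> (\<forall>\<gamma>\<in>carrier G. AE \<omega> in M. r (act \<gamma> \<omega>) = \<sigma> (\<gamma>, \<omega>) (r \<omega>))"

abbreviation circle_borel :: "complex measure" where
  "circle_borel \<equiv> restrict_space borel circle"

definition essential_image :: "'w measure \<Rightarrow> ('w \<Rightarrow> 'x::topological_space) \<Rightarrow> 'x set" where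
  "essential_image M r =
     {x. \<forall>U. open U \<longrightarrow> x \<in> U \<longrightarrow> emeasure M (r -` U \<inter> space M) > 0}"

definition left_semicohomologous ::
  "('g, 'm) monoid_scheme \<Rightarrow> 'w measure \<Rightarrow> ('g \<Rightarrow> 'w \<Rightarrow> 'w) \<Rightarrow>
   ('g \<times> 'w \<Rightarrow> (complex \<Rightarrow> complex)) \<Rightarrow> ('g \<times> 'w \<Rightarrow> (complex \<Rightarrow> complex)) \<Rightarrow> bool" where
  "left_semicohomologous G M act \<sigma>\<^sub>1 \<sigma>\<^sub>2 \<longleftrightarrow>
     (\<exists>\<phi>. \<phi> \<in> circle_borel \<Otimes>\<^sub>M M \<rightarrow>\<^sub>M circle_borel \<and>
        (AE \<omega> in M. nondecreasing_degree_one (\<lambda>z. \<phi> (z, \<omega>))) \<and>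
        (\<forall>\<gamma>\<in>carrier G. AE \<omega> in M. \<forall>z\<in>circle.
           \<sigma>\<^sub>1 (\<gamma>, \<omega>) (\<phi> (z, \<omega>)) = \<phi> (\<sigma>\<^sub>2 (\<gamma>, \<omega>) z, act \<gamma> \<omega>)))"

definition right_semicohomologous ::
  "('g, 'm) monoid_scheme \<Rightarrow> 'w measure \<Rightarrow> ('g \<Rightarrow> 'w \<Rightarrow> 'w) \<Rightarrow>
   ('g \<times> 'w \<Rightarrow> (complex \<Rightarrow> complex)) \<Rightarrow> ('g \<times> 'w \<Rightarrow> (complex \<Rightarrow> complex)) \<Rightarrow> bool" where
  "right_semicohomologous G M act \<sigma>\<^sub>1 \<sigma>\<^sub>2 \<longleftrightarrow> left_semicohomologous G M act \<sigma>\<^sub>2 \<sigma>\<^sub>1"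

definition semicohomologous ::
  "('g, 'm) monoid_scheme \<Rightarrow> 'w measure \<Rightarrow> ('g \<Rightarrow> 'w \<Rightarrow> 'w) \<Rightarrow>
   ('g \<times> 'w \<Rightarrow> (complex \<Rightarrow> complex)) \<Rightarrow> ('g \<times> 'w \<Rightarrow> (complex \<Rightarrow> complex)) \<Rightarrow> bool" where
  "semicohomologous G M act \<sigma>\<^sub>1 \<sigma>\<^sub>2 \<longleftrightarrow>
     left_semicohomologous G M act \<sigma>\<^sub>1 \<sigma>\<^sub>2 \<and> right_semicohomologous G M act \<sigma>\<^sub>1 \<sigma>\<^sub>2"


section \<open>Bounded cohomology\<close>

text \<open>The coefficients form an abelian group (written multiplicatively, following
  \<^theory>\<open>HOL-Algebra.Group\<close>) with a norm and an action of a group with elements of type \<open>'g\<close>.\<close>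

record ('a, 'g) normed_module = "'a monoid" +
  module_norm :: "'a \<Rightarrow> real"
  module_act :: "'g \<Rightarrow> 'a \<Rightarrow> 'a"

text \<open>Cochains of degree \<open>n\<close> are functions on lists of length \<open>n\<close>, undefined on all other lists.\<close>

definition tuples :: "('g, 'm) monoid_scheme \<Rightarrow> nat \<Rightarrow> 'g list set" where
  "tuples G n = {gs. length gs = n \<and> set gs \<subseteq> carrier G}"

definition bounded_cochains ::
  "nat \<Rightarrow> ('g, 'm) monoid_scheme \<Rightarrow> ('a, 'g) normed_module \<Rightarrow> ('g list \<Rightarrow> 'a) monoid" where
  "bounded_cochains n G A =
     \<lparr>carrier = {f \<in> tuples G n \<rightarrow>\<^sub>E carrier A. \<exists>C. \<forall>gs\<in>tuples G n. module_norm A (f gs) \<le> C},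
      monoid.mult = (\<lambda>f f'. \<lambda>gs\<in>tuples G n. f gs \<otimes>\<^bsub>A\<^esub> f' gs),
      one = (\<lambda>gs\<in>tuples G n. \<one>\<^bsub>A\<^esub>)\<rparr>"

definition coboundary ::
  "nat \<Rightarrow> ('g, 'm) monoid_scheme \<Rightarrow> ('a, 'g) normed_module \<Rightarrow> ('g list \<Rightarrow> 'a) \<Rightarrow> 'g list \<Rightarrow> 'a" where
  "coboundary n G A f =
     (\<lambda>gs\<in>tuples G (Suc n).
        module_act A (hd gs) (f (tl gs))
        \<otimes>\<^bsub>A\<^esub> finprod A (\<lambda>i.
              f (take (i - 1) gs @ [gs ! (i - 1) \<otimes>\<^bsub>G\<^esub> gs ! i] @ drop (i + 1) gs)
                [^]\<^bsub>A\<^esub> ((- 1) ^ i :: int)) {1..n}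
        \<otimes>\<^bsub>A\<^esub> f (butlast gs) [^]\<^bsub>A\<^esub> ((- 1) ^ (n + 1) :: int))"

definition bounded_cocycles ::
  "nat \<Rightarrow> ('g, 'm) monoid_scheme \<Rightarrow> ('a, 'g) normed_module \<Rightarrow> ('g list \<Rightarrow> 'a) monoid" where
  "bounded_cocycles n G A = (bounded_cochains n G A)\<lparr>carrier :=
     {f \<in> carrier (bounded_cochains n G A).
        coboundary n G A f = \<one>\<^bsub>bounded_cochains (Suc n) G A\<^esub>}\<rparr>"

fun bounded_coboundaries ::
  "nat \<Rightarrow> ('g, 'm) monoid_scheme \<Rightarrow> ('a, 'g) normed_module \<Rightarrow> ('g list \<Rightarrow> 'a) set" where
  "bounded_coboundaries 0 G A = {\<one>\<^bsub>bounded_cochains 0 G A\<^esub>}"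
| "bounded_coboundaries (Suc n) G A = coboundary n G A ` carrier (bounded_cochains n G A)"

definition bounded_cohomology ::
  "nat \<Rightarrow> ('g, 'm) monoid_scheme \<Rightarrow> ('a, 'g) normed_module \<Rightarrow> ('g list \<Rightarrow> 'a) set monoid" where
  "bounded_cohomology n G A = bounded_cocycles n G A Mod bounded_coboundaries n G A"

definition bounded_class ::
  "nat \<Rightarrow> ('g, 'm) monoid_scheme \<Rightarrow> ('a, 'g) normed_module \<Rightarrow> ('g list \<Rightarrow> 'a) \<Rightarrow>
   ('g list \<Rightarrow> 'a) set" where
  "bounded_class n G A f = bounded_coboundaries n G A #>\<^bsub>bounded_cocycles n G A\<^esub> f"

definition trivial_int_module :: "(int, 'g) normed_module" where
  "trivial_int_module =
     \<lparr>carrier = UNIV, monoid.mult = (+), one = 0,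
      module_norm = (\<lambda>k. real_of_int \<bar>k\<bar>), module_act = (\<lambda>_ k. k)\<rparr>"

definition ess_bounded_int :: "'w measure \<Rightarrow> ('w \<Rightarrow> int) monoid" where
  "ess_bounded_int M =
     \<lparr>carrier = {f \<in> M \<rightarrow>\<^sub>M count_space UNIV. \<exists>C. AE \<omega> in M. \<bar>f \<omega>\<bar> \<le> C},
      monoid.mult = (\<lambda>f g \<omega>. f \<omega> + g \<omega>), one = (\<lambda>_. 0)\<rparr>"

definition Linf_group :: "'w measure \<Rightarrow> ('w \<Rightarrow> int) set monoid" where
  "Linf_group M =
     ess_bounded_int M Mod {f \<in> carrier (ess_bounded_int M). AE \<omega> in M. f \<omega> = 0}"

definition Linf_class :: "'w measure \<Rightarrow> ('w \<Rightarrow> int) \<Rightarrow> ('w \<Rightarrow> int) set" where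
  "Linf_class M f =
     {f \<in> carrier (ess_bounded_int M). AE \<omega> in M. f \<omega> = 0} #>\<^bsub>ess_bounded_int M\<^esub> f"

text \<open>The union in the action is over representatives of the class \<open>X\<close>, all of which contribute
  the same class.\<close>

definition Linf_int_module ::
  "('g, 'm) monoid_scheme \<Rightarrow> 'w measure \<Rightarrow> ('g \<Rightarrow> 'w \<Rightarrow> 'w) \<Rightarrow> (('w \<Rightarrow> int) set, 'g) normed_module"
where
  "Linf_int_module G M act =
     \<lparr>carrier = carrier (Linf_group M),
      monoid.mult = monoid.mult (Linf_group M),
      one = one (Linf_group M),
      module_norm = (\<lambda>X. Inf {C. 0 \<le> C \<and> (\<forall>f\<in>X. AE \<omega> in M. real_of_int \<bar>f \<omega>\<bar> \<le> C)}),
      module_act = (\<lambda>\<gamma> X. \<Union>f\<in>X. Linf_class M (\<lambda>\<omega>. f (act (inv\<^bsub>G\<^esub> \<gamma>) \<omega>)))\<rparr>"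


section \<open>The parametrized Euler class\<close>

definition euler_section :: "(complex \<Rightarrow> complex) \<Rightarrow> (real \<Rightarrow> real)" where
  "euler_section f = (THE F. F \<in> carrier homeo_line \<and> homeo_proj F = f \<and> F 0 \<in> {0..<1})"

definition euler_cocycle :: "(complex \<Rightarrow> complex) list \<Rightarrow> int" where
  "euler_cocycle =
     (\<lambda>gs\<in>tuples homeo_circle 2.
        THE n. euler_section (gs ! 0 \<otimes>\<^bsub>homeo_circle\<^esub> gs ! 1) \<otimes>\<^bsub>homeo_line\<^esub> int_translation n =
               euler_section (gs ! 0) \<otimes>\<^bsub>homeo_line\<^esub> euler_section (gs ! 1))"

definition bounded_euler_class :: "((complex \<Rightarrow> complex) list \<Rightarrow> int) set" where
  "bounded_euler_class = bounded_class 2 homeo_circle trivial_int_module euler_cocycle"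

definition pullback_cochain ::
  "('g, 'm) monoid_scheme \<Rightarrow> 'w measure \<Rightarrow> ('g \<Rightarrow> 'w \<Rightarrow> 'w) \<Rightarrow> ('g \<times> 'w \<Rightarrow> (complex \<Rightarrow> complex)) \<Rightarrow>
   ((complex \<Rightarrow> complex) list \<Rightarrow> int) \<Rightarrow> 'g list \<Rightarrow> ('w \<Rightarrow> int) set" where
  "pullback_cochain G M act \<sigma> \<psi> =
     (\<lambda>gs\<in>tuples G 2. let \<gamma> = gs ! 0; \<eta> = gs ! 1 in
        Linf_class M (\<lambda>\<omega>. \<psi>
          [inv\<^bsub>homeo_circle\<^esub> (\<sigma> (inv\<^bsub>G\<^esub> \<gamma>, \<omega>)),
           inv\<^bsub>homeo_circle\<^esub> (\<sigma> (inv\<^bsub>G\<^esub> \<eta>, act (inv\<^bsub>G\<^esub> \<gamma>) \<omega>))]))"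

text \<open>The pullback of a cochain is a function into \<open>L\<^sup>\<infinity>\<close> only if the resulting functions of \<open>\<omega>\<close>
  are measurable, which can fail for arbitrary cochains on the discrete group; the induced map is
  therefore evaluated on Borel representatives. All of these yield the same class: if the
  coboundary of a bounded integral 1-cochain \<open>\<beta>\<close> is Borel, then so is \<open>\<beta>\<close>, because \<open>\<beta> g\<close> is the
  limit of the averages \<open>1/n \<Sum>\<^sub>0\<^sub><\<^sub>i\<^sub><\<^sub>n (\<delta>\<beta>) (g, g^i)\<close>.\<close>

definition borel_2_cochain :: "((complex \<Rightarrow> complex) list \<Rightarrow> int) \<Rightarrow> bool" where
  "borel_2_cochain \<psi> \<longleftrightarrow>
     (\<lambda>(f, g). \<psi> [f, g]) \<in> borel_homeo_circle \<Otimes>\<^sub>M borel_homeo_circle \<rightarrow>\<^sub>M count_space UNIV"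

definition bounded_pullback ::
  "('g, 'm) monoid_scheme \<Rightarrow> 'w measure \<Rightarrow> ('g \<Rightarrow> 'w \<Rightarrow> 'w) \<Rightarrow> ('g \<times> 'w \<Rightarrow> (complex \<Rightarrow> complex)) \<Rightarrow>
   ((complex \<Rightarrow> complex) list \<Rightarrow> int) set \<Rightarrow> ('g list \<Rightarrow> ('w \<Rightarrow> int) set) set" where
  "bounded_pullback G M act \<sigma> c =
     the_elem ((\<lambda>\<psi>. bounded_class 2 G (Linf_int_module G M act) (pullback_cochain G M act \<sigma> \<psi>))
       ` {\<psi> \<in> c. borel_2_cochain \<psi>})"

definition parametrized_euler_class ::
  "('g, 'm) monoid_scheme \<Rightarrow> 'w measure \<Rightarrow> ('g \<Rightarrow> 'w \<Rightarrow> 'w) \<Rightarrow> ('g \<times> 'w \<Rightarrow> (complex \<Rightarrow> complex)) \<Rightarrow>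
   ('g list \<Rightarrow> ('w \<Rightarrow> int) set) set" where
  "parametrized_euler_class G M act \<sigma> = bounded_pullback G M act \<sigma> bounded_euler_class"

end

theory Submission
  imports Defs
begin

text \<open>A family of points equivariant under \<open>\<sigma>\<close> singles out a lift of \<open>\<sigma>\<close>, namely the one that
  maps representatives in \<open>[0,1)\<close> of the points to each other. Comparing this lift with the section
  \<open>euler_section\<close> gives a bounded integer function on the group times the space whose coboundary
  is the pullback of the Euler cocycle. Conversely, a bounded primitive of that pullback turns the
  section into a lift that is a cocycle with bounded orbits, and the pointwise supremum of the
  orbit of \<open>0\<close> is equivariant because lifts are increasing and continuous. An equivariant family is
  the same as a semicohomology to the trivial cocycle by constant maps.

  All measurability questions reduce to evaluations at points, since lifts are monotone and the
  values of the section are explicit functions of the values of the circle homeomorphism.\<close>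

section \<open>Lifting circle homeomorphisms to the line\<close>

text \<open>The Euler cocycle is the integer defect of \<open>euler_section\<close> from being a
  homomorphism, and a primitive of its pullback says by which integer to correct the section at each
  group element. The bound on the primitive is uniform over the group; it keeps the corrected orbit
  of 0 bounded, so that its supremum is finite. The pullback evaluates cochains at inverses. The
  cohomological side is therefore phrased with \<open>\<tau>\<close>, whose cocycle identity has the
  shape of the action on the coefficients, and the lift of \<open>\<sigma>\<close> is recovered at
  the end by inverting. Finite generation enters as countability of the group: it makes suprema over
  the group measurable and lets identities that hold almost everywhere for single elements hold for
  all elements off one null set. An obstacle is that the cohomology of the circle group is that of a
  discrete group, whereas pulled back cochains must be measurable. Two Borel representatives of the
  Euler class differ by the coboundary of a bounded function about which nothing is known a priori;
  that this function is Borel has to be proved before its pullback makes sense.\<close>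

definition circle_arg :: "complex \<Rightarrow> real" where
  "circle_arg z = Arg2pi z / (2 * pi)"

lemma diff_IntsE:
  fixes s t :: real
  assumes "s - t \<in> \<int>"
  obtains n :: int where "s = t + n"
  using assms by (metis Ints_cases add.commute diff_eq_eq)

lemma circle_proj_in_circle [simp]: "circle_proj t \<in> circle"
  by (simp add: circle_proj_def)

lemma norm_circle_proj [simp]: "norm (circle_proj t) = 1"
  by (simp add: circle_proj_def)

lemma continuous_on_circle_proj [continuous_intros]:
  "continuous_on A f \<Longrightarrow> continuous_on A (\<lambda>x. circle_proj (f x))"
  unfolding circle_proj_def by (intro continuous_intros)

lemma circle_proj_eq_iff: "circle_proj s = circle_proj t \<longleftrightarrow> s - t \<in> \<int>"
proof -
  have "circle_proj s = circle_proj t \<longleftrightarrow>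
      sin (2 * pi * s) = sin (2 * pi * t) \<and> cos (2 * pi * s) = cos (2 * pi * t)"
    by (auto simp: circle_proj_def complex_eq_iff)
  also have "\<dots> \<longleftrightarrow> (\<exists>n::int. 2 * pi * s = 2 * pi * t + 2 * pi * n)"
    by (rule sin_cos_eq_iff)
  also have "\<dots> \<longleftrightarrow> (\<exists>n::int. s - t = n)"
  proof -
    have "2 * pi * s = 2 * pi * t + 2 * pi * n \<longleftrightarrow> s - t = n" for n :: int
    proof -
      have "2 * pi * s = 2 * pi * t + 2 * pi * n \<longleftrightarrow> 2 * pi * s = 2 * pi * (t + n)"
        by (simp add: distrib_left)
      then show ?thesis by auto
    qed
    then show ?thesis by simp
  qed
  finally show ?thesis by (auto simp: Ints_def)
qed

lemma circle_proj_add_int [simp]: "circle_proj (t + of_int n) = circle_proj t"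
  by (simp add: circle_proj_eq_iff)

lemma circle_arg_ge_0: "0 \<le> circle_arg z" and circle_arg_lt_1: "circle_arg z < 1"
  using Arg2pi[of z] by (auto simp: circle_arg_def)

lemma circle_proj_circle_arg: "z \<in> circle \<Longrightarrow> circle_proj (circle_arg z) = z"
  using complex_norm_eq_1_exp[of z]
  by (simp add: circle_proj_def circle_arg_def cis_conv_exp)

lemma circle_arg_circle_proj: "circle_arg (circle_proj t) = frac t"
proof -
  have "circle_proj (circle_arg (circle_proj t)) = circle_proj t"
    by (intro circle_proj_circle_arg) simp
  then have "t - circle_arg (circle_proj t) \<in> \<int>"
    unfolding circle_proj_eq_iff by (metis Ints_minus minus_diff_eq)
  then show ?thesis
    using circle_arg_ge_0 circle_arg_lt_1 by (metis frac_unique_iff)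
qed

lemma circle_eq_range_circle_proj: "circle = range circle_proj"
  by (auto intro: circle_proj_circle_arg[symmetric])

lemma circle_eq_image_circle_proj: "circle = circle_proj ` {0..1}"
  using circle_arg_ge_0 circle_arg_lt_1
  by (fastforce simp: less_imp_le intro: circle_proj_circle_arg[symmetric])

lemma circle_arg_measurable [measurable]: "circle_arg \<in> borel_measurable borel"
proof -
  have "Arg2pi \<in> borel_measurable borel"
    unfolding borel_measurable_iff_le by (auto intro: borel_closed closed_Arg2pi2pi_le)
  then show ?thesis unfolding circle_arg_def by measurable
qed

lemma circle_proj_measurable [measurable]: "circle_proj \<in> borel_measurable borel"
  by (intro borel_measurable_continuous_onI continuous_intros)


subsection \<open>The group of lifts\<close>

lemma shift_1_imp_shift_int:
  fixes F :: "real \<Rightarrow> real"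
  assumes "\<And>x. F (x + 1) = F x + 1"
  shows "F (x + of_int n) = F x + of_int n"
proof -
  have nat: "F (x + real k) = F x + real k" for x k
  proof (induction k)
    case (Suc k)
    show ?case using assms[of "x + real k"] Suc by (simp add: algebra_simps)
  qed simp
  show ?thesis
  proof (cases n)
    case (neg k)
    \<comment> \<open>The natural number case is applied at the point \<open>x + of_int n\<close>,
      from which \<open>Suc k\<close> steps lead back to \<open>x\<close>.\<close>
    then show ?thesis using nat[of "x + of_int n" "Suc k"] by simp
  qed (use nat in simp)
qed

text \<open>The homeomorphism property is automatic: commuting with integer translations makes the
  values at integers unbounded in both directions, so the intermediate value theorem gives
  surjectivity, and a continuous injection of the line is a homeomorphism onto its image.\<close>

lemma homeo_line_iff:
  "F \<in> carrier homeo_line \<longleftrightarrow>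
    continuous_on UNIV F \<and> strict_mono F \<and> (\<forall>x. F (x + 1) = F x + 1)"
proof safe
  assume F: "continuous_on UNIV F" "strict_mono F" "\<forall>x. F (x + 1) = F x + 1"
  have "\<exists>x. F x = y" for y
  proof -
    define n where "n = \<lfloor>y - F 0\<rfloor>"
    have "F (of_int n) = F 0 + n" "F (of_int n + 1) = F 0 + n + 1"
      using shift_1_imp_shift_int[of F 0 n] F(3) by auto
    moreover have "of_int n \<le> y - F 0" "y - F 0 < of_int n + 1"
      unfolding n_def by linarith+
    ultimately have "F n \<le> y" "y \<le> F (n + 1)"
      by auto
    then show ?thesis
      using IVT'[of F n y "n + 1"] continuous_on_subset[OF F(1)] by auto
  qed
  then have surj: "surj F" by (metis surjI)
  have inj: "inj F" using F(2) by (rule strict_mono_imp_inj_on)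
  have "\<exists>g. homeomorphism UNIV (F ` UNIV) F g"
    using injective_into_1d_eq_homeomorphism[OF F(1)] inj by simp
  then show "F \<in> carrier homeo_line"
    using F surj inj by (auto simp: homeo_line_def Bij_def bij_betw_def)
qed (auto simp: homeo_line_def homeomorphism_def)

lemma homeo_lineD:
  assumes "F \<in> carrier homeo_line"
  shows "continuous_on A F" "strict_mono F" "F (x + 1) = F x + 1"
    "F (x + of_int n) = F x + of_int n" "bij F"
proof -
  from assms show "continuous_on A F" "strict_mono F" "F (x + 1) = F x + 1"
    by (auto simp: homeo_line_iff intro: continuous_on_subset)
  show "F (x + of_int n) = F x + of_int n"
    using assms by (intro shift_1_imp_shift_int) (simp add: homeo_line_iff)
  show "bij F" using assms by (simp add: homeo_line_def Bij_def)
qed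

lemma homeo_line_less_iff: "F \<in> carrier homeo_line \<Longrightarrow> F x < F y \<longleftrightarrow> x < y"
  and homeo_line_le_iff: "F \<in> carrier homeo_line \<Longrightarrow> F x \<le> F y \<longleftrightarrow> x \<le> y"
  by (auto dest: homeo_lineD(2) simp: strict_mono_less strict_mono_less_eq)

lemma homeo_line_translate:
  "F \<in> carrier homeo_line \<Longrightarrow> (\<lambda>x. F x + c) \<in> carrier homeo_line"
  by (auto simp: homeo_line_iff strict_mono_def intro: continuous_intros)

lemma subgroup_homeo_line: "subgroup (carrier homeo_line) (BijGroup UNIV)"
proof (rule subgroup.intro)
  show "carrier homeo_line \<subseteq> carrier (BijGroup UNIV)"
    by (auto simp: homeo_line_def BijGroup_def)
next
  fix F E assume FE: "F \<in> carrier homeo_line" "E \<in> carrier homeo_line"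
  then have "F \<in> Bij UNIV" "E \<in> Bij UNIV" by (auto simp: homeo_line_def)
  moreover have "F \<circ> E \<in> carrier homeo_line"
    using FE by (auto simp: homeo_line_iff strict_mono_def intro!: continuous_on_compose2[of UNIV F])
  ultimately show "F \<otimes>\<^bsub>BijGroup UNIV\<^esub> E \<in> carrier homeo_line"
    by (simp add: BijGroup_def compose_def comp_def restrict_UNIV)
next
  show "\<one>\<^bsub>BijGroup UNIV\<^esub> \<in> carrier homeo_line"
    by (auto simp: BijGroup_def homeo_line_iff strict_mono_def)
next
  fix F assume F: "F \<in> carrier homeo_line"
  then have bij: "F \<in> Bij UNIV" by (auto simp: homeo_line_def)
  obtain E where E: "homeomorphism UNIV UNIV F E" using F by (auto simp: homeo_line_def)
  have FE: "F (E x) = x" for x using E by (auto simp: homeomorphism_def)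
  have "inv_into UNIV F = E"
    using E by (intro ext inv_f_eq) (auto simp: homeomorphism_def bij_is_inj homeo_lineD(5)[OF F])
  moreover have "E \<in> carrier homeo_line"
    unfolding homeo_line_iff
  proof safe
    show "continuous_on UNIV E" using E by (auto simp: homeomorphism_def)
    show "strict_mono E"
    proof (rule strict_monoI)
      fix x y :: real assume "x < y"
      then show "E x < E y" using homeo_line_less_iff[OF F, of "E x" "E y"] by (simp add: FE)
    qed
    fix x
    have "F (E (x + 1)) = F (E x + 1)" using homeo_lineD(3)[OF F] FE by simp
    then show "E (x + 1) = E x + 1" using homeo_lineD(5)[OF F] by (simp add: bij_def inj_eq)
  qed
  ultimately show "inv\<^bsub>BijGroup UNIV\<^esub> F \<in> carrier homeo_line"
    using bij by (simp add: inv_BijGroup restrict_UNIV)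
qed

lemma homeo_line_eq: "homeo_line = (BijGroup UNIV)\<lparr>carrier := carrier homeo_line\<rparr>"
  by (simp add: homeo_line_def)

interpretation homeo_line: group homeo_line
  using subgroup.subgroup_is_group[OF subgroup_homeo_line group_BijGroup] homeo_line_eq by metis

lemma homeo_line_mult:
  assumes "F \<in> carrier homeo_line" "E \<in> carrier homeo_line"
  shows "F \<otimes>\<^bsub>homeo_line\<^esub> E = (\<lambda>x. F (E x))"
proof -
  have "F \<in> Bij UNIV" "E \<in> Bij UNIV" using assms by (auto simp: homeo_line_def)
  then show ?thesis by (simp add: homeo_line_def BijGroup_def compose_def restrict_UNIV)
qed

lemma homeo_line_inv:
  assumes "F \<in> carrier homeo_line"
  shows "inv\<^bsub>homeo_line\<^esub> F = inv_into UNIV F"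
proof -
  have "F \<in> Bij UNIV" using assms by (auto simp: homeo_line_def)
  then show ?thesis
    using group.m_inv_consistent[OF group_BijGroup subgroup_homeo_line assms]
    by (simp add: inv_BijGroup restrict_UNIV flip: homeo_line_eq)
qed

lemma homeo_line_inv_eq:
  assumes "F \<in> carrier homeo_line"
  shows "F ((inv\<^bsub>homeo_line\<^esub> F) x) = x" "(inv\<^bsub>homeo_line\<^esub> F) (F x) = x"
  using homeo_lineD(5)[OF assms]
  by (simp_all add: homeo_line_inv[OF assms] bij_is_surj surj_f_inv_f bij_is_inj)


subsection \<open>The projection onto circle homeomorphisms\<close>

text \<open>The preimage picked by \<open>SOME\<close> differs from \<open>t\<close> by an integer,
  which \<open>F\<close> carries through and \<open>circle_proj\<close> forgets.\<close>

lemma homeo_proj_circle_proj: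
  assumes "F \<in> carrier homeo_line"
  shows "homeo_proj F (circle_proj t) = circle_proj (F t)"
proof -
  define s where "s = (SOME s. circle_proj s = circle_proj t)"
  have "circle_proj s = circle_proj t" unfolding s_def by (rule someI) simp
  then obtain n :: int where "s = t + n"
    unfolding circle_proj_eq_iff by (rule diff_IntsE)
  then have "circle_proj (F s) = circle_proj (F t)"
    by (simp add: homeo_lineD(4)[OF assms])
  then show ?thesis by (simp add: homeo_proj_def flip: s_def)
qed

lemma homeo_proj_eqI:
  assumes "F \<in> carrier homeo_line" "f \<in> extensional circle"
    and "\<And>t. f (circle_proj t) = circle_proj (F t)"
  shows "homeo_proj F = f"
proof (rule extensionalityI[OF _ assms(2)])
  show "homeo_proj F z = f z" if "z \<in> circle" for z
    using homeo_proj_circle_proj[OF assms(1), of "circle_arg z"] assms(3)[of "circle_arg z"]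
      circle_proj_circle_arg[OF that] by simp
qed (simp add: homeo_proj_def)

lemma homeo_proj_in_homeo_circle:
  assumes F: "F \<in> carrier homeo_line"
  shows "homeo_proj F \<in> carrier homeo_circle"
proof -
  let ?f = "homeo_proj F"
  note f = homeo_proj_circle_proj[OF F]
  have img: "?f ` circle = circle"
  proof -
    have "?f ` circle = circle_proj ` range F"
      by (simp add: circle_eq_range_circle_proj image_image f)
    then show ?thesis
      using homeo_lineD(5)[OF F] by (simp add: circle_eq_range_circle_proj bij_is_surj)
  qed
  have inj: "inj_on ?f circle"
  proof (rule inj_onI)
    fix z w assume "z \<in> circle" "w \<in> circle" "?f z = ?f w"
    then obtain s t where st: "z = circle_proj s" "w = circle_proj t"
      unfolding circle_eq_range_circle_proj by auto
    then have "F s - F t \<in> \<int>" using \<open>?f z = ?f w\<close> by (simp add: f circle_proj_eq_iff)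
    then obtain n :: int where "F s = F t + n"
      by (rule diff_IntsE)
    then have "F s = F (t + n)" by (simp add: homeo_lineD(4)[OF F])
    then have "s = t + n" using homeo_lineD(5)[OF F] by (simp add: bij_def inj_eq)
    then show "z = w" by (simp add: st)
  qed
  \<comment> \<open>Continuity is checked on closed sets. The preimage of a closed \<open>T\<close>
    is the image under \<open>circle_proj\<close> of a closed subset of the compact fundamental
    domain [0,1], hence compact.\<close>
  have "continuous_on circle ?f"
    unfolding continuous_on_closed img
  proof safe
    fix T assume "closedin (top_of_set circle) T"
    then have T: "closed T" "T \<subseteq> circle"
      by (auto intro: closedin_closed_trans dest: closedin_imp_subset)
    have cont: "continuous_on {0..1} (\<lambda>t. circle_proj (F t))"
      by (intro continuous_intros homeo_lineD(1)[OF F])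
    have "closed ({0..1} \<inter> (\<lambda>t. circle_proj (F t)) -` T)"
      using continuous_closed_preimage[OF cont _ T(1)] by simp
    then have "compact ({0..1} \<inter> (\<lambda>t. circle_proj (F t)) -` T)"
      by (meson bounded_closed_interval bounded_subset compact_eq_bounded_closed inf_le1)
    then have "compact (circle_proj ` ({0..1} \<inter> (\<lambda>t. circle_proj (F t)) -` T))"
      by (intro compact_continuous_image continuous_intros)
    moreover have "circle_proj ` ({0..1} \<inter> (\<lambda>t. circle_proj (F t)) -` T) = circle \<inter> ?f -` T"
      unfolding circle_eq_image_circle_proj by (auto simp: f)
    ultimately show "closedin (top_of_set circle) (circle \<inter> ?f -` T)"
      by (metis closed_subset compact_imp_closed inf_le1)
  qed
  then have "\<exists>g. homeomorphism circle circle ?f g"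
    using homeomorphism_compact[OF _ _ img inj] by auto
  moreover have "?f \<in> Bij circle"
    using img inj by (simp add: Bij_def bij_betw_def homeo_proj_def)
  ultimately show ?thesis
    using homeo_lineD(1,2)[OF F] f by (auto simp: homeo_circle_def)
qed

text \<open>The definition of the circle group supplies a continuous increasing lift, and the point
  is that it has degree one. It moves by a positive integer n over a unit interval. For n at least
  2, the value \<open>F x + 1\<close> would be taken at some y in [x, x + 1]; injectivity of
  \<open>f\<close> forces y to be an endpoint, where \<open>F\<close> has the values
  \<open>F x\<close> and \<open>F x + n\<close>.\<close>

lemma homeo_circle_lift:
  assumes "f \<in> carrier homeo_circle"
  obtains F where "F \<in> carrier homeo_line" "homeo_proj F = f"
proof -
  obtain F where F: "continuous_on UNIV F" "strict_mono F"
    "\<And>t. f (circle_proj t) = circle_proj (F t)" and f: "f \<in> Bij circle"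
    using assms by (auto simp: homeo_circle_def)
  have inj: "inj_on f circle" using f by (auto simp: Bij_def bij_betw_def)
  have "F (x + 1) = F x + 1" for x
  proof -
    have "circle_proj (F (x + 1)) = circle_proj (F x)"
      using F(3) circle_proj_add_int[of x 1] by (metis of_int_1)
    then obtain n :: int where n: "F (x + 1) = F x + n"
      unfolding circle_proj_eq_iff by (rule diff_IntsE)
    have "F x < F (x + 1)" using F(2) by (simp add: strict_mono_less)
    then have "n \<ge> 1" using n by simp
    moreover have "\<not> n \<ge> 2"
    proof
      assume "n \<ge> 2"
      then have "real_of_int n \<ge> 2" by simp
      then have "F x + 1 \<le> F (x + 1)" using n by linarith
      then obtain y where y: "x \<le> y" "y \<le> x + 1" "F y = F x + 1"
        using IVT'[of F x "F x + 1" "x + 1"] continuous_on_subset[OF F(1)] by auto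
      have "f (circle_proj y) = f (circle_proj x)"
        using circle_proj_add_int[of "F x" 1] by (simp add: F(3) y)
      then have "y - x \<in> \<int>"
        using inj_onD[OF inj, of "circle_proj y" "circle_proj x"] by (simp add: circle_proj_eq_iff)
      then have "y = x \<or> y = x + 1"
        using y(1,2) by (auto elim!: Ints_cases simp flip: of_int_le_iff) (smt (verit) of_int_le_0_iff of_int_le_1_iff of_int_1_le_iff of_int_0_le_iff of_int_less_iff)
      then show False using y n \<open>real_of_int n \<ge> 2\<close> by auto
    qed
    ultimately have "n = 1" by linarith
    then show ?thesis using n by simp
  qed
  then have "F \<in> carrier homeo_line" using F by (simp add: homeo_line_iff)
  moreover have "homeo_proj F = f"
    by (rule homeo_proj_eqI) (use calculation f F(3) in \<open>auto simp: Bij_def\<close>)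
  ultimately show ?thesis using that by blast
qed

text \<open>Closure is proved upstairs: products, inverses and the identity are projections of the
  same operations on lifts, so continuity and orientation come from
  \<open>homeo_proj_in_homeo_circle\<close>.\<close>

lemma subgroup_homeo_circle: "subgroup (carrier homeo_circle) (BijGroup circle)"
proof (rule subgroup.intro)
  show "carrier homeo_circle \<subseteq> carrier (BijGroup circle)"
    by (auto simp: homeo_circle_def BijGroup_def)
next
  fix f g assume fg: "f \<in> carrier homeo_circle" "g \<in> carrier homeo_circle"
  then obtain F E where FE: "F \<in> carrier homeo_line" "homeo_proj F = f"
    "E \<in> carrier homeo_line" "homeo_proj E = g"
    using homeo_circle_lift[OF fg(1)] homeo_circle_lift[OF fg(2)] by metis
  have bij: "f \<in> Bij circle" "g \<in> Bij circle" using fg by (auto simp: homeo_circle_def)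
  then have comp: "f \<otimes>\<^bsub>BijGroup circle\<^esub> g = compose circle f g" by (simp add: BijGroup_def)
  have *: "F \<otimes>\<^bsub>homeo_line\<^esub> E \<in> carrier homeo_line" using FE by simp
  have "homeo_proj (F \<otimes>\<^bsub>homeo_line\<^esub> E) = compose circle f g"
    by (rule homeo_proj_eqI[OF *])
      (use FE in \<open>auto simp: homeo_line_mult compose_def homeo_proj_circle_proj\<close>)
  then show "f \<otimes>\<^bsub>BijGroup circle\<^esub> g \<in> carrier homeo_circle"
    using homeo_proj_in_homeo_circle[OF *] comp by simp
next
  have "homeo_proj \<one>\<^bsub>homeo_line\<^esub> = \<one>\<^bsub>BijGroup circle\<^esub>"
    by (rule homeo_proj_eqI[OF homeo_line.one_closed]) (auto simp: BijGroup_def homeo_line_def)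
  then show "\<one>\<^bsub>BijGroup circle\<^esub> \<in> carrier homeo_circle"
    using homeo_proj_in_homeo_circle[OF homeo_line.one_closed] by simp
next
  fix f assume f: "f \<in> carrier homeo_circle"
  then obtain F where F: "F \<in> carrier homeo_line" "homeo_proj F = f"
    using homeo_circle_lift by blast
  have bij: "f \<in> Bij circle" using f by (auto simp: homeo_circle_def)
  have *: "inv\<^bsub>homeo_line\<^esub> F \<in> carrier homeo_line" using F by simp
  have "homeo_proj (inv\<^bsub>homeo_line\<^esub> F) = inv\<^bsub>BijGroup circle\<^esub> f"
  proof (rule homeo_proj_eqI[OF *])
    fix t
    have "f (circle_proj ((inv\<^bsub>homeo_line\<^esub> F) t)) = circle_proj t"
      using homeo_proj_circle_proj[OF F(1), of "(inv\<^bsub>homeo_line\<^esub> F) t"]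
      by (simp add: F homeo_line_inv_eq)
    then have "inv_into circle f (circle_proj t) = circle_proj ((inv\<^bsub>homeo_line\<^esub> F) t)"
      using bij by (intro inv_into_f_eq) (auto simp: Bij_def bij_betw_def)
    then show "(inv\<^bsub>BijGroup circle\<^esub> f) (circle_proj t) = circle_proj ((inv\<^bsub>homeo_line\<^esub> F) t)"
      by (simp add: inv_BijGroup[OF bij])
  qed (simp add: inv_BijGroup[OF bij])
  then show "inv\<^bsub>BijGroup circle\<^esub> f \<in> carrier homeo_circle"
    using homeo_proj_in_homeo_circle[OF *] by simp
qed

lemma homeo_circle_eq: "homeo_circle = (BijGroup circle)\<lparr>carrier := carrier homeo_circle\<rparr>"
  by (simp add: homeo_circle_def)

interpretation homeo_circle: group homeo_circle
  using subgroup.subgroup_is_group[OF subgroup_homeo_circle group_BijGroup] homeo_circle_eq by metis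

lemma homeo_circle_extensional: "f \<in> carrier homeo_circle \<Longrightarrow> f \<in> extensional circle"
  by (simp add: homeo_circle_def Bij_def)

lemma homeo_circle_mult:
  assumes "f \<in> carrier homeo_circle" "g \<in> carrier homeo_circle" "z \<in> circle"
  shows "(f \<otimes>\<^bsub>homeo_circle\<^esub> g) z = f (g z)"
proof -
  have "f \<in> Bij circle" "g \<in> Bij circle" using assms by (auto simp: homeo_circle_def)
  then show ?thesis using assms(3) by (simp add: homeo_circle_def BijGroup_def compose_def)
qed

lemma homeo_circle_one: "z \<in> circle \<Longrightarrow> \<one>\<^bsub>homeo_circle\<^esub> z = z"
  by (simp add: homeo_circle_def BijGroup_def)

lemma homeo_circle_inv_eq:
  assumes "f \<in> carrier homeo_circle" "z \<in> circle"
  shows "f ((inv\<^bsub>homeo_circle\<^esub> f) z) = z" "(inv\<^bsub>homeo_circle\<^esub> f) (f z) = z"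
  using homeo_circle_mult[OF assms(1) homeo_circle.inv_closed[OF assms(1)] assms(2)]
    homeo_circle_mult[OF homeo_circle.inv_closed[OF assms(1)] assms] assms homeo_circle_one
  by auto

lemma homeo_proj_mult:
  assumes "F \<in> carrier homeo_line" "E \<in> carrier homeo_line"
  shows "homeo_proj (F \<otimes>\<^bsub>homeo_line\<^esub> E) = homeo_proj F \<otimes>\<^bsub>homeo_circle\<^esub> homeo_proj E"
  by (rule homeo_proj_eqI[OF homeo_line.m_closed[OF assms]])
    (use assms in \<open>auto simp: homeo_line_mult homeo_circle_mult homeo_proj_circle_proj
       homeo_proj_in_homeo_circle intro: homeo_circle_extensional\<close>)

lemma homeo_proj_hom: "group_hom homeo_line homeo_circle homeo_proj"
  by unfold_locales (auto simp: hom_def homeo_proj_mult homeo_proj_in_homeo_circle)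


subsection \<open>The section with values at the origin in the unit interval\<close>

text \<open>A lift \<open>F\<close> maps \<open>[0,1)\<close> into \<open>[F 0, F 0 + 1)\<close>, so its values are determined by \<open>F 0\<close>
  and their fractional parts.\<close>

lemma homeo_line_explicit:
  assumes "F \<in> carrier homeo_line"
  shows "F x = F 0 + \<lfloor>x\<rfloor> + frac (circle_arg (homeo_proj F (circle_proj x)) - F 0)"
proof -
  have "F x = F (frac x) + \<lfloor>x\<rfloor>"
    using homeo_lineD(4)[OF assms, of "frac x" "\<lfloor>x\<rfloor>"] by (simp add: frac_def)
  moreover have "F 0 \<le> F (frac x)" "F (frac x) < F 0 + 1"
    using homeo_line_le_iff[OF assms] homeo_line_less_iff[OF assms, of "frac x" "0 + 1"]
      homeo_lineD(3)[OF assms, of 0] frac_lt_1[of x] by simp_all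
  ultimately have "frac (F x - F 0) = F x - F 0 - \<lfloor>x\<rfloor>"
    unfolding frac_unique_iff by auto
  moreover have "frac (circle_arg (homeo_proj F (circle_proj x)) - F 0) = frac (F x - F 0)"
  proof -
    have "frac (F x) - F 0 = (F x - F 0) + of_int (- \<lfloor>F x\<rfloor>)" by (simp add: frac_def)
    then show ?thesis
      by (simp only: homeo_proj_circle_proj[OF assms] circle_arg_circle_proj frac_add_of_int_right)
  qed
  ultimately show ?thesis by simp
qed

text \<open>In the explicit formula the fractional part sees \<open>F 0\<close> only modulo
  integers. Lifts of one map therefore differ by the same integer everywhere, and agreement at one
  point makes it 0.\<close>

lemma homeo_line_eqI:
  assumes "F \<in> carrier homeo_line" "E \<in> carrier homeo_line"
    and "homeo_proj F = homeo_proj E" "F x = E x"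
  shows "F = E"
proof -
  have *: "\<exists>n::int. \<forall>y. F y = E y + n"
  proof -
    have "F 0 - E 0 \<in> \<int>"
      using homeo_proj_circle_proj[OF assms(1), of 0] homeo_proj_circle_proj[OF assms(2), of 0]
        assms(3) by (simp flip: circle_proj_eq_iff)
    then obtain n :: int where n: "F 0 = E 0 + n"
      by (rule diff_IntsE)
    have "frac (a - (E 0 + n)) = frac (a - E 0)" for a
      using frac_add_of_int_right[of "a - (E 0 + n)" n] by (simp add: algebra_simps)
    then have "F y = E y + n" for y
      using homeo_line_explicit[OF assms(1), of y] homeo_line_explicit[OF assms(2), of y] assms(3) n
      by simp
    then show ?thesis by blast
  qed
  then show ?thesis using assms(4) by auto
qed

text \<open>The point \<open>x\<close> is free, so the integer that separates two lifts can be
  measured wherever it is convenient.\<close>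

lemma homeo_line_eq_translate:
  assumes "F \<in> carrier homeo_line" "E \<in> carrier homeo_line" "homeo_proj F = homeo_proj E"
  shows "F y = E y + (F x - E x)" "F x - E x \<in> \<int>"
proof -
  show int: "F x - E x \<in> \<int>"
    using homeo_proj_circle_proj[OF assms(1), of x] homeo_proj_circle_proj[OF assms(2), of x]
      assms(3) by (simp flip: circle_proj_eq_iff)
  define E' where "E' = (\<lambda>y. E y + (F x - E x))"
  have E': "E' \<in> carrier homeo_line" unfolding E'_def by (rule homeo_line_translate[OF assms(2)])
  have "homeo_proj E' = homeo_proj E"
    by (rule homeo_proj_eqI[OF E'])
      (use int Ints_minus[OF int] in \<open>auto simp: E'_def homeo_proj_circle_proj[OF assms(2)] circle_proj_eq_iff
        homeo_circle_extensional homeo_proj_in_homeo_circle[OF assms(2)]\<close>)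
  then have "F = E'" using assms by (intro homeo_line_eqI[OF assms(1) E', of x]) (auto simp: E'_def)
  then show "F y = E y + (F x - E x)" unfolding E'_def by (rule fun_cong)
qed

lemma homeo_proj_translate:
  assumes "F \<in> carrier homeo_line"
  shows "homeo_proj (\<lambda>x. F x + of_int n) = homeo_proj F"
  by (rule homeo_proj_eqI[OF homeo_line_translate[OF assms]])
    (auto simp: homeo_proj_circle_proj[OF assms] homeo_circle_extensional
      homeo_proj_in_homeo_circle[OF assms])

text \<open>Justifies the definite description: subtracting the floor of \<open>F 0\<close>
  normalises any lift, and two normalised lifts differ by an integer strictly between -1 and
  1.\<close>

lemma euler_section:
  assumes "f \<in> carrier homeo_circle"
  shows "euler_section f \<in> carrier homeo_line" "homeo_proj (euler_section f) = f"
    "0 \<le> euler_section f 0" "euler_section f 0 < 1"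
proof -
  obtain F where F: "F \<in> carrier homeo_line" "homeo_proj F = f"
    using homeo_circle_lift[OF assms] by blast
  define E where "E = (\<lambda>x. F x + of_int (- \<lfloor>F 0\<rfloor>))"
  have E: "E \<in> carrier homeo_line \<and> homeo_proj E = f \<and> E 0 \<in> {0..<1}"
    using homeo_line_translate[OF F(1), of "of_int (- \<lfloor>F 0\<rfloor>)"] homeo_proj_translate[OF F(1), of "- \<lfloor>F 0\<rfloor>"]
      F(2) frac_lt_1[of "F 0"] frac_ge_0[of "F 0"] by (simp add: E_def frac_def)
  have "\<exists>!E. E \<in> carrier homeo_line \<and> homeo_proj E = f \<and> E 0 \<in> {0..<1}"
  proof (intro ex1I)
    show "E \<in> carrier homeo_line \<and> homeo_proj E = f \<and> E 0 \<in> {0..<1}" by (fact E)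
    fix E' assume E': "E' \<in> carrier homeo_line \<and> homeo_proj E' = f \<and> E' 0 \<in> {0..<1}"
    then have "E' 0 - E 0 \<in> \<int>" using E by (intro homeo_line_eq_translate(2)) auto
    then obtain n :: int where n: "E' 0 = E 0 + n" by (rule diff_IntsE)
    then have "real_of_int n < 1" "-1 < real_of_int n" using E E' by auto
    then have "n = 0" by linarith
    then show "E' = E" using E E' n by (intro homeo_line_eqI[of E' E 0]) auto
  qed
  from theI'[OF this] show "euler_section f \<in> carrier homeo_line"
    "homeo_proj (euler_section f) = f" "0 \<le> euler_section f 0" "euler_section f 0 < 1"
    by (simp_all add: euler_section_def)
qed

lemma circle_proj_euler_section:
  "f \<in> carrier homeo_circle \<Longrightarrow> circle_proj (euler_section f x) = f (circle_proj x)"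
  using homeo_proj_circle_proj[OF euler_section(1), of f x] by (simp add: euler_section(2))

lemma euler_section_0: "f \<in> carrier homeo_circle \<Longrightarrow> euler_section f 0 = circle_arg (f 1)"
proof -
  assume f: "f \<in> carrier homeo_circle"
  have "circle_proj 0 = 1" by (simp add: circle_proj_def)
  then have "circle_arg (f 1) = frac (euler_section f 0)"
    using circle_proj_euler_section[OF f, of 0] circle_arg_circle_proj[of "euler_section f 0"] by simp
  then show ?thesis using euler_section[OF f] by simp
qed

lemma euler_section_explicit:
  assumes "f \<in> carrier homeo_circle"
  shows "euler_section f x =
    circle_arg (f 1) + \<lfloor>x\<rfloor> + frac (circle_arg (f (circle_proj x)) - circle_arg (f 1))"
  using homeo_line_explicit[OF euler_section(1)[OF assms], of x]
  by (simp add: euler_section[OF assms] euler_section_0[OF assms])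

text \<open>Both sides of the defining equation lift the same circle map, so their difference is an
  integer that does not depend on \<open>x\<close>. Evaluating at 0 yields bounds and measurability;
  evaluating at a lift of an equivariant point yields a primitive.\<close>

lemma euler_cocycle_eq:
  assumes f: "f \<in> carrier homeo_circle" and g: "g \<in> carrier homeo_circle"
  shows "real_of_int (euler_cocycle [f, g]) =
    euler_section f (euler_section g x) - euler_section (f \<otimes>\<^bsub>homeo_circle\<^esub> g) x"
proof -
  let ?fg = "f \<otimes>\<^bsub>homeo_circle\<^esub> g"
  have fg: "?fg \<in> carrier homeo_circle" using f g by simp
  note s = euler_section[OF f] euler_section[OF g] euler_section[OF fg]
  let ?m = "euler_section f \<otimes>\<^bsub>homeo_line\<^esub> euler_section g"
  have m: "?m = (\<lambda>x. euler_section f (euler_section g x))" using s by (simp add: homeo_line_mult)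
  have mc: "?m \<in> carrier homeo_line" using s by simp
  have "homeo_proj ?m = homeo_proj (euler_section ?fg)" using s by (simp add: homeo_proj_mult)
  note t = homeo_line_eq_translate[OF mc s(9) this]
  obtain n :: int where n: "?m x - euler_section ?fg x = n" using t(2)[of x] by (auto elim: Ints_cases)
  have tr: "int_translation k \<in> carrier homeo_line" for k
    by (auto simp: homeo_line_iff int_translation_def strict_mono_def intro: continuous_intros)
  have "euler_section ?fg \<otimes>\<^bsub>homeo_line\<^esub> int_translation k = ?m \<longleftrightarrow> k = n" for k
  proof -
    have "euler_section ?fg \<otimes>\<^bsub>homeo_line\<^esub> int_translation k = (\<lambda>y. euler_section ?fg y + k)"
      using s tr by (simp add: homeo_line_mult int_translation_def homeo_lineD(4))
    moreover have "?m = (\<lambda>y. euler_section ?fg y + n)" using t(1)[of _ x] n by auto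
    ultimately show ?thesis by (auto simp: fun_eq_iff)
  qed
  moreover have "[f, g] \<in> tuples homeo_circle 2" using f g by (simp add: tuples_def)
  ultimately have "euler_cocycle [f, g] = n" by (simp add: euler_cocycle_def)
  then show ?thesis using n m by simp
qed


section \<open>Measurability of the group operations\<close>

lemma topspace_compact_open [simp]: "topspace (compact_open_topology S F) = F"
proof -
  \<comment> \<open>The empty compact set imposes no condition, so all of \<open>F\<close> is a
    subbasic open set.\<close>
  have "{f \<in> F. f ` {} \<subseteq> UNIV} \<in> {{f \<in> F. f ` K \<subseteq> U} | K U. compact K \<and> K \<subseteq> S \<and> open U}"
    using compact_empty open_UNIV by blast
  then show ?thesis
    unfolding compact_open_topology_def topology_generated_by_topspace by auto
qed

lemma openin_subset_Pow: "{U. openin X U} \<subseteq> Pow (topspace X)"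
  by (auto dest: openin_subset)

lemma space_borel_of [simp]: "space (borel_of X) = topspace X"
  using openin_subset_Pow[of X] by (simp add: borel_of_def)

lemma sets_borel_of: "openin X U \<Longrightarrow> U \<in> sets (borel_of X)"
  using openin_subset_Pow[of X] by (simp add: borel_of_def)

lemma space_borel_homeo_circle [simp]: "space borel_homeo_circle = carrier homeo_circle"
  and space_borel_homeo_line [simp]: "space borel_homeo_line = carrier homeo_line"
  by (simp_all add: borel_homeo_circle_def borel_homeo_line_def)

lemma measurable_apply_compact_open:
  assumes "x \<in> S"
  shows "(\<lambda>f. f x) \<in> borel_of (compact_open_topology S F) \<rightarrow>\<^sub>M borel"
proof (rule borel_measurableI)
  fix U :: "'b set" assume "open U"
  then have "openin (compact_open_topology S F) {f \<in> F. f ` {x} \<subseteq> U}"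
    unfolding compact_open_topology_def using assms
    by (intro topology_generated_by_Basis) (blast intro: compact_sing)
  from sets_borel_of[OF this]
  show "(\<lambda>f. f x) -` U \<inter> space (borel_of (compact_open_topology S F))
      \<in> sets (borel_of (compact_open_topology S F))"
    by (auto simp: vimage_def Int_def conj_commute)
qed

lemma measurable_homeo_circle_apply_const:
  "X \<in> N \<rightarrow>\<^sub>M borel_homeo_circle \<Longrightarrow> z \<in> circle \<Longrightarrow> (\<lambda>\<omega>. X \<omega> z) \<in> borel_measurable N"
  unfolding borel_homeo_circle_def
  by (rule measurable_compose[OF _ measurable_apply_compact_open])

lemma measurable_homeo_line_apply_const:
  "Y \<in> N \<rightarrow>\<^sub>M borel_homeo_line \<Longrightarrow> (\<lambda>\<omega>. Y \<omega> x) \<in> borel_measurable N"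
  unfolding borel_homeo_line_def
  by (rule measurable_compose[OF _ measurable_apply_compact_open]) auto

text \<open>Since lifts are monotone, a condition \<open>F ` K \<subseteq> U\<close> can be checked at the endpoints of finitely
  many rational intervals covering \<open>K\<close>. Hence the compact-open topology has a countable basis of
  sets described by evaluations.\<close>

definition rational_nbhd :: "(rat \<times> rat \<times> rat \<times> rat) set \<Rightarrow> (real \<Rightarrow> real) set" where
  "rational_nbhd I = {F \<in> carrier homeo_line.
     \<forall>(p, q, a, b)\<in>I. of_rat a < F (of_rat p) \<and> F (of_rat q) < of_rat b}"

lemma rational_nbhd_subbasis:
  assumes F: "F \<in> carrier homeo_line" and K: "compact K" "F ` K \<subseteq> U" and U: "open U"
  shows "\<exists>I. finite I \<and> F \<in> rational_nbhd I \<and> rational_nbhd I \<subseteq> {E \<in> carrier homeo_line. E ` K \<subseteq> U}"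
proof -
  \<comment> \<open>All rational tests that \<open>F\<close> passes and that are strong enough for
    \<open>U\<close>: by monotonicity the bounds at p and q confine the image of the interval from p
    to q to the interval from a to b.\<close>
  define J where "J = {(p, q, a, b) | p q a b :: rat. of_rat a < F (of_rat p) \<and> F (of_rat q) < of_rat b
    \<and> {real_of_rat a<..<of_rat b} \<subseteq> U}"
  define T where "T = (\<lambda>(p, q, a :: rat, b :: rat). {real_of_rat p<..<of_rat q})"
  have "K \<subseteq> (\<Union>j\<in>J. T j)"
  proof
    fix x assume "x \<in> K"
    then have "F x \<in> U" using K by auto
    with U obtain e where e: "e > 0" "ball (F x) e \<subseteq> U" by (rule openE)
    obtain a where a: "F x - e < real_of_rat a" "real_of_rat a < F x"
      using of_rat_dense[of "F x - e" "F x"] e(1) by auto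
    obtain b where b: "F x < real_of_rat b" "real_of_rat b < F x + e"
      using of_rat_dense[of "F x" "F x + e"] e(1) by auto
    note ab = a b
    have sub: "{real_of_rat a<..<of_rat b} \<subseteq> U"
      using ab by (intro order_trans[OF _ e(2)]) (auto simp: dist_real_def)
    have "open (F -` {real_of_rat a<..<of_rat b})"
      using homeo_lineD(1)[OF F, of UNIV] by (intro open_vimage) auto
    moreover have "x \<in> F -` {real_of_rat a<..<of_rat b}" using ab by simp
    ultimately obtain d where d: "d > 0" "ball x d \<subseteq> F -` {real_of_rat a<..<of_rat b}"
      by (rule openE)
    obtain p where p: "x - d < real_of_rat p" "real_of_rat p < x"
      using of_rat_dense[of "x - d" x] d(1) by auto
    obtain q where q: "x < real_of_rat q" "real_of_rat q < x + d"
      using of_rat_dense[of x "x + d"] d(1) by auto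
    note pq = p q
    have "real_of_rat p \<in> ball x d" "real_of_rat q \<in> ball x d" using pq by (auto simp: dist_real_def)
    then have "(p, q, a, b) \<in> J" using d(2) sub by (auto simp: J_def)
    moreover have "x \<in> T (p, q, a, b)" using pq by (simp add: T_def)
    ultimately show "x \<in> (\<Union>j\<in>J. T j)" by blast
  qed
  then obtain I where I: "I \<subseteq> J" "finite I" "K \<subseteq> (\<Union>j\<in>I. T j)"
  proof -
    have "open (T j)" for j by (simp add: T_def split: prod.splits)
    then show ?thesis using compactE_image[OF K(1) _ \<open>K \<subseteq> (\<Union>j\<in>J. T j)\<close>] that by blast
  qed
  have "E x \<in> U" if E: "E \<in> rational_nbhd I" and "x \<in> K" for E x
  proof -
    obtain p q a b where j: "(p, q, a, b) \<in> I" "x \<in> T (p, q, a, b)"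
      using I(3) \<open>x \<in> K\<close> by fastforce
    have Ec: "E \<in> carrier homeo_line" and "of_rat a < E (of_rat p)" "E (of_rat q) < of_rat b"
      using E j(1) by (auto simp: rational_nbhd_def)
    moreover have "E (of_rat p) < E x" "E x < E (of_rat q)"
      using j(2) homeo_line_less_iff[OF Ec] by (auto simp: T_def)
    ultimately have "E x \<in> {real_of_rat a<..<of_rat b}" by auto
    moreover have "{real_of_rat a<..<of_rat b} \<subseteq> U" using I(1) j(1) by (auto simp: J_def)
    ultimately show ?thesis by blast
  qed
  moreover have "F \<in> rational_nbhd I" using F I(1) by (auto simp: rational_nbhd_def J_def)
  ultimately show ?thesis using I(2) by (intro exI[of _ I]) (auto simp: rational_nbhd_def)
qed

text \<open>Induction over the generation of the topology: intersections of basic sets correspond to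
  unions of their finite index sets.\<close>

lemma rational_nbhd_basis:
  assumes "openin (compact_open_topology UNIV (carrier homeo_line)) U" "F \<in> U"
  shows "\<exists>I. finite I \<and> F \<in> rational_nbhd I \<and> rational_nbhd I \<subseteq> U"
proof -
  have "generate_topology_on
      {{f \<in> carrier homeo_line. f ` K \<subseteq> V} | K V. compact K \<and> K \<subseteq> UNIV \<and> open V} U"
    using assms(1) unfolding compact_open_topology_def by (rule openin_topology_generated_by)
  then show ?thesis using assms(2)
  proof induction
    case (Int U V)
    then obtain I J where "finite I" "F \<in> rational_nbhd I" "rational_nbhd I \<subseteq> U"
      "finite J" "F \<in> rational_nbhd J" "rational_nbhd J \<subseteq> V" by blast
    moreover have "rational_nbhd (I \<union> J) = rational_nbhd I \<inter> rational_nbhd J"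
      by (auto simp: rational_nbhd_def ball_Un)
    ultimately show ?case by (intro exI[of _ "I \<union> J"]) auto
  next
    case (UN \<K>)
    from UN.prems obtain U where U: "U \<in> \<K>" "F \<in> U" by blast
    obtain I where "finite I" "F \<in> rational_nbhd I" "rational_nbhd I \<subseteq> U"
      using UN.IH[OF U] by blast
    then show ?case using U(1) by (intro exI[of _ I]) auto
  next
    case (Basis V)
    then obtain K W where V: "V = {f \<in> carrier homeo_line. f ` K \<subseteq> W}" and "compact K" "open W"
      by blast
    then show ?case using rational_nbhd_subbasis[of F K W] Basis.prems unfolding V by simp
  qed simp
qed

text \<open>There are only countably many finite sets of rational tests, so an open set is a
  countable union of basic ones and its preimage is built from evaluations at rational
  points.\<close>

lemma measurable_homeo_lineI:
  assumes Y: "\<And>\<omega>. \<omega> \<in> space N \<Longrightarrow> Y \<omega> \<in> carrier homeo_line"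
    and [measurable]: "\<And>x. (\<lambda>\<omega>. Y \<omega> x) \<in> borel_measurable N"
  shows "Y \<in> N \<rightarrow>\<^sub>M borel_homeo_line"
proof -
  let ?X = "compact_open_topology UNIV (carrier homeo_line)"
  have "Y -` U \<inter> space N \<in> sets N" if U: "openin ?X U" for U
  proof -
    define \<I> where "\<I> = {I. finite I \<and> rational_nbhd I \<subseteq> U}"
    have "countable {I :: (rat \<times> rat \<times> rat \<times> rat) set. finite I \<and> I \<subseteq> UNIV}"
      by (intro countable_Collect_finite_subset) auto
    then have "countable \<I>" by (rule countable_subset[rotated]) (auto simp: \<I>_def)
    moreover have "Y -` rational_nbhd I \<inter> space N \<in> sets N" if "finite I" for I
    proof -
      have "Y -` rational_nbhd I \<inter> space N = {\<omega> \<in> space N. \<forall>j\<in>I.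
          of_rat (fst (snd (snd j))) < Y \<omega> (of_rat (fst j)) \<and>
          Y \<omega> (of_rat (fst (snd j))) < of_rat (snd (snd (snd j)))}"
        using Y by (auto simp: rational_nbhd_def)
      also have "\<dots> \<in> sets N" using that by measurable
      finally show ?thesis .
    qed
    ultimately have "(\<Union>I\<in>\<I>. Y -` rational_nbhd I \<inter> space N) \<in> sets N"
      by (intro sets.countable_UN') (auto simp: \<I>_def)
    moreover have U_eq: "U = (\<Union>I\<in>\<I>. rational_nbhd I)"
      using rational_nbhd_basis[OF U] unfolding \<I>_def by blast
    have "Y -` U \<inter> space N = (\<Union>I\<in>\<I>. Y -` rational_nbhd I \<inter> space N)"
      unfolding U_eq by blast
    ultimately show ?thesis by simp
  qed
  then show ?thesis
    unfolding borel_homeo_line_def borel_of_def using Y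
    by (intro measurable_measure_of openin_subset_Pow) auto
qed

text \<open>The projection is continuous: a condition on the image of \<open>K\<close> becomes a
  condition on the image of the compact set \<open>K'\<close> of representatives of \<open>K\<close>
  in [0,1], which is again subbasic.\<close>

lemma homeo_proj_measurable [measurable]: "homeo_proj \<in> borel_homeo_line \<rightarrow>\<^sub>M borel_homeo_circle"
proof -
  let ?L = "compact_open_topology UNIV (carrier homeo_line)"
  let ?C = "compact_open_topology circle (carrier homeo_circle)"
  have "continuous_map ?L ?C homeo_proj"
    unfolding compact_open_topology_def[of circle]
  proof (rule continuous_on_generated_topo)
    fix W assume "W \<in> {{f \<in> carrier homeo_circle. f ` K \<subseteq> U} | K U. compact K \<and> K \<subseteq> circle \<and> open U}"
    then obtain K U where W: "W = {f \<in> carrier homeo_circle. f ` K \<subseteq> U}"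
      and K: "compact K" "K \<subseteq> circle" and U: "open U" by blast
    define K' where "K' = {0..1} \<inter> circle_proj -` K"
    have cont: "continuous_on A circle_proj" for A
      by (intro continuous_intros)
    have "closed K'" unfolding K'_def
      using K cont by (intro continuous_closed_preimage) (auto simp: compact_imp_closed)
    then have "compact K'"
      by (metis K'_def bounded_closed_interval bounded_subset compact_eq_bounded_closed inf_le1)
    moreover have "open (circle_proj -` U)" using U cont by (intro open_vimage)
    moreover have "circle_proj ` K' = K"
      using K(2) unfolding K'_def circle_eq_image_circle_proj by auto
    from this[symmetric] have "homeo_proj F \<in> W \<longleftrightarrow> F ` K' \<subseteq> circle_proj -` U"
      if "F \<in> carrier homeo_line" for F
      using homeo_proj_circle_proj[OF that] homeo_proj_in_homeo_circle[OF that]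
      by (auto simp: W image_image)
    then have "homeo_proj -` W \<inter> topspace ?L
        = {F \<in> carrier homeo_line. F ` K' \<subseteq> circle_proj -` U}"
      by auto
    ultimately show "openin ?L (homeo_proj -` W \<inter> topspace ?L)"
      unfolding compact_open_topology_def[of UNIV] by (auto intro!: topology_generated_by_Basis)
  next
    show "homeo_proj ` topspace ?L
        \<subseteq> \<Union> {{f \<in> carrier homeo_circle. f ` K \<subseteq> U} | K U. compact K \<and> K \<subseteq> circle \<and> open U}"
      using homeo_proj_in_homeo_circle topspace_compact_open[of circle "carrier homeo_circle"]
      unfolding compact_open_topology_def[of circle] topology_generated_by_topspace by auto
  qed
  then have "homeo_proj -` U \<inter> space borel_homeo_line \<in> sets borel_homeo_line" if "openin ?C U" for U
  proof -
    assume "continuous_map ?L ?C homeo_proj"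
    then have "openin ?L {F \<in> carrier homeo_line. homeo_proj F \<in> U}"
      using openin_continuous_map_preimage[OF _ that] by fastforce
    moreover have "homeo_proj -` U \<inter> space borel_homeo_line
        = {F \<in> carrier homeo_line. homeo_proj F \<in> U}" by auto
    ultimately show ?thesis by (simp add: borel_homeo_line_def sets_borel_of)
  qed
  then show ?thesis
    unfolding borel_homeo_circle_def borel_of_def
    by (intro measurable_measure_of openin_subset_Pow) (auto simp: homeo_proj_in_homeo_circle)
qed

text \<open>The section is discontinuous, because its value at 0 jumps when \<open>f 1\<close>
  passes through 1. Its evaluations are nevertheless Borel functions of two values of
  \<open>f\<close>.\<close>

lemma euler_section_measurable [measurable]:
  "euler_section \<in> borel_homeo_circle \<rightarrow>\<^sub>M borel_homeo_line"
proof (rule measurable_homeo_lineI)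
  fix x
  have [measurable]: "(\<lambda>f. f z) \<in> borel_measurable borel_homeo_circle" if "z \<in> circle" for z
    using measurable_homeo_circle_apply_const[OF measurable_ident that] by (simp add: id_def)
  have "(1::complex) \<in> circle" by simp
  then have "(\<lambda>f. circle_arg (f 1) + \<lfloor>x\<rfloor> + frac (circle_arg (f (circle_proj x)) - circle_arg (f 1)))
      \<in> borel_measurable borel_homeo_circle"
    unfolding frac_def by measurable
  then show "(\<lambda>f. euler_section f x) \<in> borel_measurable borel_homeo_circle"
    by (rule measurable_cong[THEN iffD1, rotated]) (simp add: euler_section_explicit)
qed (simp add: euler_section)

text \<open>Evaluation at a moving point. By continuity and monotonicity the value is below
  \<open>a\<close> exactly if this holds at some rational to the right of the point, which leaves a
  countable union of conditions at fixed points.\<close>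

lemma homeo_line_apply_measurable:
  assumes Y[measurable]: "Y \<in> N \<rightarrow>\<^sub>M borel_homeo_line" and [measurable]: "x \<in> borel_measurable N"
  shows "(\<lambda>\<omega>. Y \<omega> (x \<omega>)) \<in> borel_measurable N"
  unfolding borel_measurable_iff_less
proof
  fix a :: real
  note measurable_homeo_line_apply_const[OF Y, measurable]
  have "Y \<omega> (x \<omega>) < a \<longleftrightarrow> (\<exists>q::rat. x \<omega> < of_rat q \<and> Y \<omega> (of_rat q) < a)" if "\<omega> \<in> space N" for \<omega>
  proof -
    have F: "Y \<omega> \<in> carrier homeo_line" using measurable_space[OF Y that] by simp
    show ?thesis
    proof safe
      assume "Y \<omega> (x \<omega>) < a"
      then have "x \<omega> \<in> Y \<omega> -` {..<a}" by simp
      moreover have "open (Y \<omega> -` {..<a})"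
        using homeo_lineD(1)[OF F, of UNIV] by (intro open_vimage) auto
      ultimately obtain d where d: "d > 0" "ball (x \<omega>) d \<subseteq> Y \<omega> -` {..<a}"
        by (metis openE)
      obtain q where "x \<omega> < real_of_rat q" "real_of_rat q < x \<omega> + d"
        using of_rat_dense[of "x \<omega>" "x \<omega> + d"] d(1) by auto
      then show "\<exists>q::rat. x \<omega> < of_rat q \<and> Y \<omega> (of_rat q) < a"
        using d(2) by (intro exI[of _ q]) (auto simp: dist_real_def subset_eq)
    next
      fix q :: rat assume "x \<omega> < of_rat q" "Y \<omega> (of_rat q) < a"
      then show "Y \<omega> (x \<omega>) < a" using homeo_line_less_iff[OF F, of "x \<omega>" "of_rat q"] by simp
    qed
  qed
  then have "{\<omega> \<in> space N. Y \<omega> (x \<omega>) < a}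
      = {\<omega> \<in> space N. \<exists>q::rat. x \<omega> < of_rat q \<and> Y \<omega> (of_rat q) < a}" by blast
  also have "\<dots> \<in> sets N" by measurable
  finally show "{\<omega> \<in> space N. Y \<omega> (x \<omega>) < a} \<in> sets N" .
qed

lemma homeo_line_mult_measurable [measurable]:
  assumes [measurable]: "X \<in> N \<rightarrow>\<^sub>M borel_homeo_line" "Y \<in> N \<rightarrow>\<^sub>M borel_homeo_line"
  shows "(\<lambda>\<omega>. X \<omega> \<otimes>\<^bsub>homeo_line\<^esub> Y \<omega>) \<in> N \<rightarrow>\<^sub>M borel_homeo_line"
proof (rule measurable_homeo_lineI)
  fix x
  have carrier: "X \<omega> \<in> carrier homeo_line" "Y \<omega> \<in> carrier homeo_line" if "\<omega> \<in> space N" for \<omega>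
    using measurable_space[OF assms(1) that] measurable_space[OF assms(2) that] by simp_all
  then show "X \<omega> \<otimes>\<^bsub>homeo_line\<^esub> Y \<omega> \<in> carrier homeo_line" if "\<omega> \<in> space N" for \<omega>
    using that by simp
  have "(\<lambda>\<omega>. X \<omega> (Y \<omega> x)) \<in> borel_measurable N"
    by (rule homeo_line_apply_measurable[OF assms(1) measurable_homeo_line_apply_const[OF assms(2)]])
  then show "(\<lambda>\<omega>. (X \<omega> \<otimes>\<^bsub>homeo_line\<^esub> Y \<omega>) x) \<in> borel_measurable N"
    by (rule measurable_cong[THEN iffD1, rotated]) (simp add: homeo_line_mult carrier)
qed

text \<open>Since lifts are increasing, the inverse at x lies below a exactly if x lies below the
  value at a, which is an evaluation.\<close>

lemma homeo_line_inv_measurable [measurable]: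
  assumes X[measurable]: "X \<in> N \<rightarrow>\<^sub>M borel_homeo_line"
  shows "(\<lambda>\<omega>. inv\<^bsub>homeo_line\<^esub> X \<omega>) \<in> N \<rightarrow>\<^sub>M borel_homeo_line"
proof (rule measurable_homeo_lineI)
  have carrier: "X \<omega> \<in> carrier homeo_line" if "\<omega> \<in> space N" for \<omega>
    using measurable_space[OF X that] by simp
  then show "inv\<^bsub>homeo_line\<^esub> X \<omega> \<in> carrier homeo_line" if "\<omega> \<in> space N" for \<omega>
    using that by simp
  fix x
  have "(inv\<^bsub>homeo_line\<^esub> X \<omega>) x < a \<longleftrightarrow> x < X \<omega> a" if "\<omega> \<in> space N" for \<omega> a
    using homeo_line_less_iff[OF carrier[OF that], of "(inv\<^bsub>homeo_line\<^esub> X \<omega>) x" a]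
    by (simp add: homeo_line_inv_eq carrier that)
  then have "{\<omega> \<in> space N. (inv\<^bsub>homeo_line\<^esub> X \<omega>) x < a} = {\<omega> \<in> space N. x < X \<omega> a}" for a
    by blast
  moreover have "{\<omega> \<in> space N. x < X \<omega> a} \<in> sets N" for a
    using measurable_homeo_line_apply_const[OF X, of a] by measurable
  ultimately show "(\<lambda>\<omega>. (inv\<^bsub>homeo_line\<^esub> X \<omega>) x) \<in> borel_measurable N"
    unfolding borel_measurable_iff_less by simp
qed

text \<open>Here and for inverses the operation is factored through the line: apply the section,
  operate on lifts, project back. All three maps are already known to be measurable.\<close>

lemma homeo_circle_mult_measurable [measurable]:
  assumes [measurable]: "X \<in> N \<rightarrow>\<^sub>M borel_homeo_circle" "Y \<in> N \<rightarrow>\<^sub>M borel_homeo_circle"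
  shows "(\<lambda>\<omega>. X \<omega> \<otimes>\<^bsub>homeo_circle\<^esub> Y \<omega>) \<in> N \<rightarrow>\<^sub>M borel_homeo_circle"
proof -
  have "X \<omega> \<in> carrier homeo_circle" "Y \<omega> \<in> carrier homeo_circle" if "\<omega> \<in> space N" for \<omega>
    using measurable_space[OF assms(1) that] measurable_space[OF assms(2) that] by simp_all
  note carrier = this
  have "(\<lambda>\<omega>. homeo_proj (euler_section (X \<omega>) \<otimes>\<^bsub>homeo_line\<^esub> euler_section (Y \<omega>)))
      \<in> N \<rightarrow>\<^sub>M borel_homeo_circle" by measurable
  then show ?thesis
    by (rule measurable_cong[THEN iffD1, rotated])
      (simp add: homeo_proj_mult euler_section carrier)
qed

lemma homeo_circle_inv_measurable [measurable]:
  assumes X[measurable]: "X \<in> N \<rightarrow>\<^sub>M borel_homeo_circle"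
  shows "(\<lambda>\<omega>. inv\<^bsub>homeo_circle\<^esub> X \<omega>) \<in> N \<rightarrow>\<^sub>M borel_homeo_circle"
proof -
  have carrier: "X \<omega> \<in> carrier homeo_circle" if "\<omega> \<in> space N" for \<omega>
    using measurable_space[OF X that] by simp
  have "(\<lambda>\<omega>. homeo_proj (inv\<^bsub>homeo_line\<^esub> euler_section (X \<omega>))) \<in> N \<rightarrow>\<^sub>M borel_homeo_circle"
    by measurable
  then show ?thesis
    by (rule measurable_cong[THEN iffD1, rotated])
      (simp add: group_hom.hom_inv[OF homeo_proj_hom] euler_section carrier)
qed

lemma euler_cocycle_measurable:
  assumes X[measurable]: "X \<in> N \<rightarrow>\<^sub>M borel_homeo_circle" and Y[measurable]: "Y \<in> N \<rightarrow>\<^sub>M borel_homeo_circle"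
  shows "(\<lambda>\<omega>. euler_cocycle [X \<omega>, Y \<omega>]) \<in> N \<rightarrow>\<^sub>M count_space UNIV"
proof -
  note lift = measurable_compose[OF _ euler_section_measurable]
  note evals[measurable] =
    homeo_line_apply_measurable[OF lift[OF X] measurable_homeo_line_apply_const[OF lift[OF Y]]]
    measurable_homeo_line_apply_const[OF lift[OF homeo_circle_mult_measurable[OF X Y]]]
  \<comment> \<open>The floor does not change the value, which is an integer; it moves measurability
    from the reals to the discrete space of integers.\<close>
  have "(\<lambda>\<omega>. \<lfloor>euler_section (X \<omega>) (euler_section (Y \<omega>) 0)
      - euler_section (X \<omega> \<otimes>\<^bsub>homeo_circle\<^esub> Y \<omega>) 0\<rfloor>) \<in> N \<rightarrow>\<^sub>M count_space UNIV" by measurable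
  moreover have "\<lfloor>euler_section (X \<omega>) (euler_section (Y \<omega>) 0)
      - euler_section (X \<omega> \<otimes>\<^bsub>homeo_circle\<^esub> Y \<omega>) 0\<rfloor> = euler_cocycle [X \<omega>, Y \<omega>]"
    if "\<omega> \<in> space N" for \<omega>
    using measurable_space[OF X that] measurable_space[OF Y that]
    by (simp flip: euler_cocycle_eq)
  ultimately show ?thesis by (rule measurable_cong[THEN iffD1, rotated])
qed

lemma borel_2_cochain_euler_cocycle: "borel_2_cochain euler_cocycle"
  unfolding borel_2_cochain_def case_prod_beta
  by (intro euler_cocycle_measurable measurable_fst measurable_snd)


section \<open>Bounded cohomology in degree two\<close>

lemma tuples_0: "tuples G 0 = {[]}"
  by (auto simp: tuples_def)

lemma tuples_Suc: "tuples G (Suc n) = (\<lambda>(a, gs). a # gs) ` (carrier G \<times> tuples G n)"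
  by (auto simp: tuples_def length_Suc_conv image_iff)

lemma tuples_1: "tuples G (Suc 0) = {[a] | a. a \<in> carrier G}"
  and tuples_2: "tuples G 2 = {[a, b] | a b. a \<in> carrier G \<and> b \<in> carrier G}"
  by (auto simp: tuples_0 tuples_Suc numeral_2_eq_2)

lemma in_tuples_1 [simp]: "[a] \<in> tuples G (Suc 0) \<longleftrightarrow> a \<in> carrier G"
  and in_tuples_2 [simp]: "[a, b] \<in> tuples G 2 \<longleftrightarrow> a \<in> carrier G \<and> b \<in> carrier G"
  by (auto simp: tuples_1 tuples_2)

lemma bounded_cochains_simps:
  "f \<in> carrier (bounded_cochains n G A) \<longleftrightarrow>
     f \<in> tuples G n \<rightarrow>\<^sub>E carrier A \<and> (\<exists>C. \<forall>gs\<in>tuples G n. module_norm A (f gs) \<le> C)"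
  "f \<otimes>\<^bsub>bounded_cochains n G A\<^esub> f' = (\<lambda>gs\<in>tuples G n. f gs \<otimes>\<^bsub>A\<^esub> f' gs)"
  "\<one>\<^bsub>bounded_cochains n G A\<^esub> = (\<lambda>gs\<in>tuples G n. \<one>\<^bsub>A\<^esub>)"
  by (simp_all add: bounded_cochains_def)

lemma bounded_coboundaries_2:
  "bounded_coboundaries 2 G A = coboundary 1 G A ` carrier (bounded_cochains 1 G A)"
  by (simp add: numeral_2_eq_2)

text \<open>A coset depends on the multiplication alone, which cocycles inherit from cochains. Coset
  arguments can thus be carried out in the group of bounded cochains.\<close>

lemma bounded_class_eq_r_coset:
  "bounded_class n G A f = bounded_coboundaries n G A #>\<^bsub>bounded_cochains n G A\<^esub> f"
  by (simp add: bounded_class_def r_coset_def bounded_cocycles_def)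

lemma one_bounded_cohomology: "\<one>\<^bsub>bounded_cohomology n G A\<^esub> = bounded_coboundaries n G A"
  by (simp add: bounded_cohomology_def)

text \<open>The norm axioms are the inequalities that keep products, inverses and coboundaries of
  bounded cochains bounded.\<close>

locale isometric_module = comm_group A + G: group G
  for G :: "('g, 'm) monoid_scheme" and A :: "('a, 'g) normed_module" (structure) +
  assumes act_closed: "\<lbrakk>g \<in> carrier G; x \<in> carrier A\<rbrakk> \<Longrightarrow> module_act A g x \<in> carrier A"
    and act_mult: "\<lbrakk>g \<in> carrier G; x \<in> carrier A; y \<in> carrier A\<rbrakk> \<Longrightarrow>
      module_act A g (x \<otimes> y) = module_act A g x \<otimes> module_act A g y"
    and norm_mult: "\<lbrakk>x \<in> carrier A; y \<in> carrier A\<rbrakk> \<Longrightarrow>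
      module_norm A (x \<otimes> y) \<le> module_norm A x + module_norm A y"
    and norm_inv: "x \<in> carrier A \<Longrightarrow> module_norm A (inv x) \<le> module_norm A x"
    and norm_act: "\<lbrakk>g \<in> carrier G; x \<in> carrier A\<rbrakk> \<Longrightarrow>
      module_norm A (module_act A g x) \<le> module_norm A x"
begin

lemma coboundary_1:
  assumes f: "f \<in> tuples G 1 \<rightarrow> carrier A" and a: "a \<in> carrier G" and b: "b \<in> carrier G"
  shows "coboundary 1 G A f [a, b] = module_act A a (f [b]) \<otimes> inv (f [a \<otimes>\<^bsub>G\<^esub> b]) \<otimes> f [a]"
proof -
  have "f [c] \<in> carrier A" if "c \<in> carrier G" for c using f that by (auto simp: Pi_iff tuples_1)
  moreover have "[a, b] \<in> tuples G (Suc 1)" using a b by (simp add: tuples_def)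
  ultimately show ?thesis
    using a b by (simp add: coboundary_def int_pow_neg)
qed

lemma coboundary_extensional: "coboundary n G A f \<in> extensional (tuples G (Suc n))"
  by (simp add: coboundary_def)

lemma comm_group_bounded_cochains: "comm_group (bounded_cochains n G A)"
proof (rule comm_groupI)
  fix f f' assume "f \<in> carrier (bounded_cochains n G A)" "f' \<in> carrier (bounded_cochains n G A)"
  then obtain C C' where f: "f \<in> tuples G n \<rightarrow>\<^sub>E carrier A" "\<forall>gs\<in>tuples G n. module_norm A (f gs) \<le> C"
    and f': "f' \<in> tuples G n \<rightarrow>\<^sub>E carrier A" "\<forall>gs\<in>tuples G n. module_norm A (f' gs) \<le> C'"
    unfolding bounded_cochains_simps by blast
  have "module_norm A (f gs \<otimes> f' gs) \<le> C + C'" if "gs \<in> tuples G n" for gs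
    using norm_mult[OF PiE_mem[OF f(1) that] PiE_mem[OF f'(1) that]] f(2) f'(2) that
    by (meson add_mono order_trans)
  then show "f \<otimes>\<^bsub>bounded_cochains n G A\<^esub> f' \<in> carrier (bounded_cochains n G A)"
    using f f' by (auto simp: bounded_cochains_simps PiE_mem intro!: exI[of _ "C + C'"])
  show "f \<otimes>\<^bsub>bounded_cochains n G A\<^esub> f' = f' \<otimes>\<^bsub>bounded_cochains n G A\<^esub> f"
    using f f' by (auto simp: bounded_cochains_simps intro!: restrict_ext m_comm)
next
  fix f f' f'' assume "f \<in> carrier (bounded_cochains n G A)" "f' \<in> carrier (bounded_cochains n G A)"
    "f'' \<in> carrier (bounded_cochains n G A)"
  then show "f \<otimes>\<^bsub>bounded_cochains n G A\<^esub> f' \<otimes>\<^bsub>bounded_cochains n G A\<^esub> f''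
      = f \<otimes>\<^bsub>bounded_cochains n G A\<^esub> (f' \<otimes>\<^bsub>bounded_cochains n G A\<^esub> f'')"
    by (auto simp: bounded_cochains_simps intro!: restrict_ext m_assoc)
next
  show "\<one>\<^bsub>bounded_cochains n G A\<^esub> \<in> carrier (bounded_cochains n G A)"
    by (auto simp: bounded_cochains_simps)
next
  fix f assume f: "f \<in> carrier (bounded_cochains n G A)"
  then show "\<one>\<^bsub>bounded_cochains n G A\<^esub> \<otimes>\<^bsub>bounded_cochains n G A\<^esub> f = f"
    by (auto simp: bounded_cochains_simps PiE_iff intro!: extensionalityI[of _ "tuples G n"] l_one)
  let ?h = "\<lambda>gs\<in>tuples G n. inv (f gs)"
  obtain C where C: "\<And>gs. gs \<in> tuples G n \<Longrightarrow> module_norm A (f gs) \<le> C"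
    using f by (auto simp: bounded_cochains_simps)
  have "f gs \<in> carrier A" if "gs \<in> tuples G n" for gs using f that by (auto simp: bounded_cochains_simps)
  then have "?h \<in> carrier (bounded_cochains n G A)"
    "?h \<otimes>\<^bsub>bounded_cochains n G A\<^esub> f = \<one>\<^bsub>bounded_cochains n G A\<^esub>"
    using norm_inv C by (auto simp: bounded_cochains_simps intro!: exI[of _ C] restrict_ext intro: order_trans)
  then show "\<exists>h\<in>carrier (bounded_cochains n G A).
      h \<otimes>\<^bsub>bounded_cochains n G A\<^esub> f = \<one>\<^bsub>bounded_cochains n G A\<^esub>" by blast
qed

lemma group_bounded_cochains: "group (bounded_cochains n G A)"
  using comm_group_bounded_cochains comm_group.axioms(2) by blast

text \<open>Makes the coboundaries a subgroup, being the image of a homomorphism. The bound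
  \<open>3 * C\<close> in the proof counts the three factors of the coboundary.\<close>

lemma coboundary_1_hom:
  "coboundary 1 G A \<in> hom (bounded_cochains 1 G A) (bounded_cochains 2 G A)"
proof (rule homI)
  fix f assume "f \<in> carrier (bounded_cochains 1 G A)"
  then obtain C where f: "f \<in> tuples G 1 \<rightarrow>\<^sub>E carrier A" "\<And>gs. gs \<in> tuples G 1 \<Longrightarrow> module_norm A (f gs) \<le> C"
    by (auto simp: bounded_cochains_simps)
  have fc: "f [a] \<in> carrier A" "module_norm A (f [a]) \<le> C" if "a \<in> carrier G" for a
    using PiE_mem[OF f(1), of "[a]"] f(2)[of "[a]"] that by simp_all
  have "f \<in> tuples G 1 \<rightarrow> carrier A" using f by auto
  note c = coboundary_1[OF this]
  have "module_norm A (coboundary 1 G A f [a, b]) \<le> 3 * C"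
    and "coboundary 1 G A f [a, b] \<in> carrier A" if a: "a \<in> carrier G" and b: "b \<in> carrier G" for a b
  proof -
    have ab: "a \<otimes>\<^bsub>G\<^esub> b \<in> carrier G" using a b by simp
    have m: "module_act A a (f [b]) \<in> carrier A" "inv (f [a \<otimes>\<^bsub>G\<^esub> b]) \<in> carrier A"
      using act_closed fc a b ab by auto
    show "coboundary 1 G A f [a, b] \<in> carrier A" using c[OF a b] m fc(1)[OF a] by simp
    show "module_norm A (coboundary 1 G A f [a, b]) \<le> 3 * C"
      using norm_mult[OF m_closed[OF m] fc(1)[OF a]] norm_mult[OF m]
        norm_act[OF a fc(1)[OF b]] norm_inv[OF fc(1)[OF ab]] fc(2)[OF a] fc(2)[OF b] fc(2)[OF ab]
      unfolding c[OF a b] by linarith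
  qed
  then show "coboundary 1 G A f \<in> carrier (bounded_cochains 2 G A)"
    using coboundary_extensional[of 1 f]
    by (auto simp: bounded_cochains_simps tuples_2 PiE_iff numeral_2_eq_2[symmetric])
next
  fix f f' assume ff': "f \<in> carrier (bounded_cochains 1 G A)" "f' \<in> carrier (bounded_cochains 1 G A)"
  let ?ff' = "f \<otimes>\<^bsub>bounded_cochains 1 G A\<^esub> f'"
  have "?ff' \<in> carrier (bounded_cochains 1 G A)"
    using ff' by (simp add: group_bounded_cochains group.is_monoid monoid.m_closed)
  then have "f \<in> tuples G 1 \<rightarrow> carrier A" "f' \<in> tuples G 1 \<rightarrow> carrier A" "?ff' \<in> tuples G 1 \<rightarrow> carrier A"
    using ff' unfolding bounded_cochains_simps(1) by auto
  note c = this[THEN coboundary_1]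
  have fc: "f [a] \<in> carrier A" "f' [a] \<in> carrier A" if "a \<in> carrier G" for a
    using ff' that by (auto simp: bounded_cochains_simps(1))
  show "coboundary 1 G A ?ff' = coboundary 1 G A f \<otimes>\<^bsub>bounded_cochains 2 G A\<^esub> coboundary 1 G A f'"
    unfolding bounded_cochains_simps(2)[where n = 2]
  proof (rule extensionalityI)
    show "coboundary 1 G A ?ff' \<in> extensional (tuples G 2)"
      using coboundary_extensional[of 1] by (simp add: numeral_2_eq_2)
  next
    fix gs assume "gs \<in> tuples G 2"
    then obtain a b where gs: "gs = [a, b]" and ab: "a \<in> carrier G" "b \<in> carrier G"
      by (auto simp: tuples_2)
    show "coboundary 1 G A ?ff' gs
        = (\<lambda>gs\<in>tuples G 2. coboundary 1 G A f gs \<otimes> coboundary 1 G A f' gs) gs"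
      using ab fc unfolding gs c(3)[OF ab]
      by (simp add: c[unfolded One_nat_def] bounded_cochains_simps(2) act_mult inv_mult act_closed m_ac)
  qed simp
qed

lemma subgroup_bounded_coboundaries_2:
  "subgroup (bounded_coboundaries 2 G A) (bounded_cochains 2 G A)"
proof -
  interpret group_hom "bounded_cochains 1 G A" "bounded_cochains 2 G A" "coboundary 1 G A"
    by (intro group_hom.intro group_hom_axioms.intro group_bounded_cochains coboundary_1_hom)
  show ?thesis unfolding bounded_coboundaries_2 by (rule img_is_subgroup)
qed

lemma bounded_class_2_eq_one_iff:
  assumes "f \<in> carrier (bounded_cochains 2 G A)"
  shows "bounded_class 2 G A f = \<one>\<^bsub>bounded_cohomology 2 G A\<^esub> \<longleftrightarrow> f \<in> bounded_coboundaries 2 G A"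
  unfolding bounded_class_eq_r_coset one_bounded_cohomology
  using group.coset_join1[OF group_bounded_cochains _ assms subgroup_bounded_coboundaries_2]
    group.coset_join2[OF group_bounded_cochains assms subgroup_bounded_coboundaries_2] by blast

lemma bounded_class_2_mult_coboundary:
  assumes f: "f \<in> carrier (bounded_cochains 2 G A)" and b: "b \<in> bounded_coboundaries 2 G A"
  shows "bounded_class 2 G A (b \<otimes>\<^bsub>bounded_cochains 2 G A\<^esub> f) = bounded_class 2 G A f"
proof -
  note B = subgroup_bounded_coboundaries_2
  have b': "b \<in> carrier (bounded_cochains 2 G A)" using subgroup.mem_carrier[OF B b] .
  show ?thesis
    unfolding bounded_class_eq_r_coset
    using group.coset_mult_assoc[OF group_bounded_cochains subgroup.subset[OF B] b' f]
      group.coset_join2[OF group_bounded_cochains b' B b] by simp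
qed

end

interpretation int_module: isometric_module homeo_circle "trivial_int_module :: (int, complex \<Rightarrow> complex) normed_module"
proof -
  let ?A = "trivial_int_module :: (int, complex \<Rightarrow> complex) normed_module"
  interpret A: comm_group ?A
    by (rule comm_groupI) (auto simp: trivial_int_module_def intro: exI[of _ "- _"])
  have "inv\<^bsub>?A\<^esub> x = - x" for x
    by (rule A.inv_equality) (auto simp: trivial_int_module_def)
  then show "isometric_module homeo_circle ?A"
    by unfold_locales (auto simp: trivial_int_module_def)
qed

lemma trivial_int_module_simps [simp]:
  "carrier trivial_int_module = UNIV" "x \<otimes>\<^bsub>trivial_int_module\<^esub> y = x + y"
  "module_act trivial_int_module g x = x" "module_norm trivial_int_module x = real_of_int \<bar>x\<bar>"
  by (simp_all add: trivial_int_module_def)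

lemma trivial_int_module_inv [simp]:
  "inv\<^bsub>trivial_int_module :: (int, complex \<Rightarrow> complex) normed_module\<^esub> x = - x"
  by (rule int_module.inv_equality) (auto simp: trivial_int_module_def)


section \<open>The module of essentially bounded integer functions\<close>

lemma ess_bounded_int_simps:
  "f \<in> carrier (ess_bounded_int M) \<longleftrightarrow>
     f \<in> M \<rightarrow>\<^sub>M count_space UNIV \<and> (\<exists>C. AE \<omega> in M. \<bar>f \<omega>\<bar> \<le> C)"
  "f \<otimes>\<^bsub>ess_bounded_int M\<^esub> g = (\<lambda>\<omega>. f \<omega> + g \<omega>)"
  "\<one>\<^bsub>ess_bounded_int M\<^esub> = (\<lambda>_. 0)"
  by (simp_all add: ess_bounded_int_def)

lemma ess_bounded_int_measurable:
  "f \<in> carrier (ess_bounded_int M) \<Longrightarrow> f \<in> M \<rightarrow>\<^sub>M count_space UNIV"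
  by (simp add: ess_bounded_int_simps)

lemma ess_bounded_int_add:
  assumes "f \<in> carrier (ess_bounded_int M)" "g \<in> carrier (ess_bounded_int M)"
  shows "(\<lambda>\<omega>. f \<omega> + g \<omega>) \<in> carrier (ess_bounded_int M)"
proof -
  have [measurable]: "f \<in> M \<rightarrow>\<^sub>M count_space UNIV" "g \<in> M \<rightarrow>\<^sub>M count_space UNIV"
    using assms by (auto simp: ess_bounded_int_simps)
  obtain C C' where "AE \<omega> in M. \<bar>f \<omega>\<bar> \<le> C" "AE \<omega> in M. \<bar>g \<omega>\<bar> \<le> C'"
    using assms by (auto simp: ess_bounded_int_simps)
  then have "AE \<omega> in M. \<bar>f \<omega> + g \<omega>\<bar> \<le> C + C'" by eventually_elim auto
  then show ?thesis by (auto simp: ess_bounded_int_simps)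
qed

lemma ess_bounded_int_uminus:
  assumes "f \<in> carrier (ess_bounded_int M)"
  shows "(\<lambda>\<omega>. - f \<omega>) \<in> carrier (ess_bounded_int M)"
proof -
  have [measurable]: "f \<in> M \<rightarrow>\<^sub>M count_space UNIV" using assms by (auto simp: ess_bounded_int_simps)
  obtain C where "AE \<omega> in M. \<bar>f \<omega>\<bar> \<le> C" using assms by (auto simp: ess_bounded_int_simps)
  then have "AE \<omega> in M. \<bar>- f \<omega>\<bar> \<le> C" by simp
  moreover have "(\<lambda>\<omega>. - f \<omega>) \<in> M \<rightarrow>\<^sub>M count_space UNIV" by measurable
  ultimately show ?thesis unfolding ess_bounded_int_simps by blast
qed

lemma ess_bounded_int_diff:
  assumes "f \<in> carrier (ess_bounded_int M)" "g \<in> carrier (ess_bounded_int M)"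
  shows "(\<lambda>\<omega>. f \<omega> - g \<omega>) \<in> carrier (ess_bounded_int M)"
  using ess_bounded_int_add[OF assms(1) ess_bounded_int_uminus[OF assms(2)]] by simp

lemma ess_bounded_intI:
  assumes "f \<in> M \<rightarrow>\<^sub>M count_space UNIV" "AE \<omega> in M. real_of_int \<bar>f \<omega>\<bar> \<le> C"
  shows "f \<in> carrier (ess_bounded_int M)"
proof -
  have "AE \<omega> in M. \<bar>f \<omega>\<bar> \<le> \<lfloor>C\<rfloor>"
    using assms(2) by eventually_elim (simp add: le_floor_iff)
  then show ?thesis using assms(1) by (auto simp: ess_bounded_int_simps)
qed

lemma comm_group_ess_bounded_int: "comm_group (ess_bounded_int M)"
proof (rule comm_groupI)
  show "\<exists>g\<in>carrier (ess_bounded_int M). g \<otimes>\<^bsub>ess_bounded_int M\<^esub> f = \<one>\<^bsub>ess_bounded_int M\<^esub>"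
    if "f \<in> carrier (ess_bounded_int M)" for f
    using ess_bounded_int_uminus[OF that] by (intro bexI[of _ "\<lambda>\<omega>. - f \<omega>"]) (simp_all add: ess_bounded_int_simps(2,3))
  show "\<one>\<^bsub>ess_bounded_int M\<^esub> \<in> carrier (ess_bounded_int M)"
    by (auto simp: ess_bounded_int_simps)
qed (use ess_bounded_int_add in \<open>auto simp: ess_bounded_int_simps(2,3)\<close>)

lemma ess_bounded_int_inv:
  assumes "f \<in> carrier (ess_bounded_int M)"
  shows "inv\<^bsub>ess_bounded_int M\<^esub> f = (\<lambda>\<omega>. - f \<omega>)"
  using assms ess_bounded_int_uminus[OF assms] comm_group_ess_bounded_int
  by (intro group.inv_equality) (auto simp: ess_bounded_int_simps comm_group_def)

lemma normal_null_functions: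
  "{f \<in> carrier (ess_bounded_int M). AE \<omega> in M. f \<omega> = 0} \<lhd> ess_bounded_int M"
proof -
  interpret comm_group "ess_bounded_int M" by (rule comm_group_ess_bounded_int)
  have "subgroup {f \<in> carrier (ess_bounded_int M). AE \<omega> in M. f \<omega> = 0} (ess_bounded_int M)"
  proof (rule subgroupI)
    have "\<one>\<^bsub>ess_bounded_int M\<^esub> \<in> {f \<in> carrier (ess_bounded_int M). AE \<omega> in M. f \<omega> = 0}"
      using one_closed by (simp add: ess_bounded_int_simps(3))
    then show "{f \<in> carrier (ess_bounded_int M). AE \<omega> in M. f \<omega> = 0} \<noteq> {}" by blast
  qed (use ess_bounded_int_uminus ess_bounded_int_add in
      \<open>auto simp: ess_bounded_int_inv ess_bounded_int_simps(2)\<close>)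
  then show ?thesis by (simp add: normal_iff_subgroup)
qed

lemma Linf_class_eq:
  assumes f: "f \<in> carrier (ess_bounded_int M)"
  shows "Linf_class M f = {h \<in> carrier (ess_bounded_int M). AE \<omega> in M. h \<omega> = f \<omega>}"
proof safe
  fix h assume "h \<in> Linf_class M f"
  then show "h \<in> carrier (ess_bounded_int M)" "AE \<omega> in M. h \<omega> = f \<omega>"
    using f ess_bounded_int_add by (auto simp: Linf_class_def r_coset_def ess_bounded_int_simps(2))
next
  fix h assume h: "h \<in> carrier (ess_bounded_int M)" "AE \<omega> in M. h \<omega> = f \<omega>"
  have "(\<lambda>\<omega>. h \<omega> - f \<omega>) \<in> carrier (ess_bounded_int M)"
    using h(1) f by (rule ess_bounded_int_diff)
  moreover have "AE \<omega> in M. h \<omega> - f \<omega> = 0" using h(2) by eventually_elim simp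
  ultimately show "h \<in> Linf_class M f"
    by (auto simp: Linf_class_def r_coset_def ess_bounded_int_simps(2)
        intro!: exI[of _ "\<lambda>\<omega>. h \<omega> - f \<omega>"])
qed

lemma Linf_class_eq_iff:
  assumes "f \<in> carrier (ess_bounded_int M)" "g \<in> carrier (ess_bounded_int M)"
  shows "Linf_class M f = Linf_class M g \<longleftrightarrow> (AE \<omega> in M. f \<omega> = g \<omega>)"
proof
  assume "Linf_class M f = Linf_class M g"
  moreover have "f \<in> Linf_class M f" using assms by (simp add: Linf_class_eq)
  ultimately show "AE \<omega> in M. f \<omega> = g \<omega>" using assms by (simp add: Linf_class_eq)
next
  assume "AE \<omega> in M. f \<omega> = g \<omega>"
  then have "(AE \<omega> in M. h \<omega> = f \<omega>) \<longleftrightarrow> (AE \<omega> in M. h \<omega> = g \<omega>)" for h by (intro eventually_subst) (elim eventually_mono, simp)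
  then show "Linf_class M f = Linf_class M g" using assms by (simp add: Linf_class_eq)
qed

lemma Linf_int_module_carrier:
  "carrier (Linf_int_module G M act) = Linf_class M ` carrier (ess_bounded_int M)"
  by (simp add: Linf_int_module_def Linf_group_def carrier_FactGroup Linf_class_def)

lemma Linf_class_mult:
  assumes "f \<in> carrier (ess_bounded_int M)" "g \<in> carrier (ess_bounded_int M)"
  shows "Linf_class M f \<otimes>\<^bsub>Linf_int_module G M act\<^esub> Linf_class M g = Linf_class M (\<lambda>\<omega>. f \<omega> + g \<omega>)"
  using normal.rcos_sum[OF normal_null_functions assms]
  by (simp add: Linf_int_module_def Linf_group_def Linf_class_def ess_bounded_int_simps(2))

lemma Linf_int_module_one: "\<one>\<^bsub>Linf_int_module G M act\<^esub> = Linf_class M (\<lambda>_. 0)"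
proof -
  have "(\<lambda>_. 0) \<in> carrier (ess_bounded_int M)" by (auto simp: ess_bounded_int_simps)
  then show ?thesis
    by (simp add: Linf_int_module_def Linf_group_def Linf_class_eq)
qed

lemma comm_group_Linf_int_module: "comm_group (Linf_int_module G M act)"
proof -
  interpret comm_group "Linf_group M"
    unfolding Linf_group_def
    using comm_group.abelian_FactGroup[OF comm_group_ess_bounded_int]
      normal_imp_subgroup[OF normal_null_functions] .
  show ?thesis
    by (rule comm_groupI) (simp_all add: Linf_int_module_def m_ac l_inv_ex)
qed

lemma Linf_class_inv:
  assumes f: "f \<in> carrier (ess_bounded_int M)"
  shows "inv\<^bsub>Linf_int_module G M act\<^esub> Linf_class M f = Linf_class M (\<lambda>\<omega>. - f \<omega>)"
proof (rule group.inv_equality)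
  show "group (Linf_int_module G M act)"
    using comm_group_Linf_int_module comm_group.axioms(2) by blast
qed (use f ess_bounded_int_uminus[OF f] in
    \<open>auto simp: Linf_class_mult Linf_int_module_one Linf_int_module_carrier\<close>)

text \<open>Members of a class agree almost everywhere and so have the same essential bounds; the
  quantifier over the class in the norm collapses to one representative.\<close>

lemma Linf_norm_eq:
  assumes f: "f \<in> carrier (ess_bounded_int M)"
  shows "module_norm (Linf_int_module G M act) (Linf_class M f)
    = Inf {C. 0 \<le> C \<and> (AE \<omega> in M. real_of_int \<bar>f \<omega>\<bar> \<le> C)}"
proof -
  have "(\<forall>h\<in>Linf_class M f. AE \<omega> in M. real_of_int \<bar>h \<omega>\<bar> \<le> D) \<longleftrightarrow> (AE \<omega> in M. real_of_int \<bar>f \<omega>\<bar> \<le> D)" for D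
  proof
    assume "\<forall>h\<in>Linf_class M f. AE \<omega> in M. real_of_int \<bar>h \<omega>\<bar> \<le> D"
    then show "AE \<omega> in M. real_of_int \<bar>f \<omega>\<bar> \<le> D" using f by (simp add: Linf_class_eq)
  next
    assume D: "AE \<omega> in M. real_of_int \<bar>f \<omega>\<bar> \<le> D"
    show "\<forall>h\<in>Linf_class M f. AE \<omega> in M. real_of_int \<bar>h \<omega>\<bar> \<le> D"
    proof
      fix h assume "h \<in> Linf_class M f"
      then have "AE \<omega> in M. h \<omega> = f \<omega>" using f by (simp add: Linf_class_eq)
      then show "AE \<omega> in M. real_of_int \<bar>h \<omega>\<bar> \<le> D" using D by eventually_elim simp
    qed
  qed
  then show ?thesis by (simp add: Linf_int_module_def)
qed

lemma Linf_norm_le: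
  assumes f: "f \<in> carrier (ess_bounded_int M)" and C: "0 \<le> C" "AE \<omega> in M. real_of_int \<bar>f \<omega>\<bar> \<le> C"
  shows "module_norm (Linf_int_module G M act) (Linf_class M f) \<le> C"
  unfolding Linf_norm_eq[OF f] using C by (intro cInf_lower) (auto intro: bdd_belowI[of _ 0])

text \<open>The infimum of the essential bounds is itself an essential bound: the exceptional sets
  for the bounds \<open>D + 1 / Suc n\<close> have a null union.\<close>

lemma Linf_norm_nonneg_AE:
  assumes f: "f \<in> carrier (ess_bounded_int M)"
  shows "0 \<le> module_norm (Linf_int_module G M act) (Linf_class M f)" (is "0 \<le> ?D")
    and "AE \<omega> in M. real_of_int \<bar>f \<omega>\<bar> \<le> module_norm (Linf_int_module G M act) (Linf_class M f)"
proof -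
  define D where "D = ?D"
  let ?S = "{C. 0 \<le> C \<and> (AE \<omega> in M. real_of_int \<bar>f \<omega>\<bar> \<le> C)}"
  have D: "D = Inf ?S"
    unfolding D_def by (rule Linf_norm_eq[OF f])
  obtain K where "AE \<omega> in M. \<bar>f \<omega>\<bar> \<le> K" using f by (auto simp: ess_bounded_int_simps)
  then have "AE \<omega> in M. real_of_int \<bar>f \<omega>\<bar> \<le> \<bar>real_of_int K\<bar>" by eventually_elim linarith
  then have ne: "?S \<noteq> {}" by (auto intro!: exI[of _ "\<bar>real_of_int K\<bar>"])
  then have "0 \<le> D" unfolding D by (intro cInf_greatest) auto
  then show "0 \<le> ?D" by (simp add: D_def)
  have "AE \<omega> in M. real_of_int \<bar>f \<omega>\<bar> \<le> D + 1 / Suc n" for n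
  proof -
    have "Inf ?S < D + 1 / Suc n" by (simp add: D)
    then obtain C where C: "C \<in> ?S" "C < D + 1 / Suc n"
      using cInf_lessD[OF ne] by blast
    then have "AE \<omega> in M. real_of_int \<bar>f \<omega>\<bar> \<le> C" by simp
    then show ?thesis by eventually_elim (use C(2) in simp)
  qed
  then have "AE \<omega> in M. \<forall>n. real_of_int \<bar>f \<omega>\<bar> \<le> D + 1 / Suc n" by (simp add: AE_all_countable)
  then show "AE \<omega> in M. real_of_int \<bar>f \<omega>\<bar> \<le> ?D"
    unfolding D_def[symmetric]
  proof eventually_elim
    case (elim \<omega>)
    show ?case
    proof (rule field_le_epsilon)
      fix e :: real assume "e > 0"
      then obtain n where "1 / Suc n < e" by (metis nat_approx_posE)
      with elim[rule_format, of n] show "real_of_int \<bar>f \<omega>\<bar> \<le> D + e" by simp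
    qed
  qed
qed

section \<open>Measure preserving actions and the induced action on coefficients\<close>

locale prob_space_action = group G for G (structure) +
  fixes M :: "'w measure" and act
  assumes action: "standard_borel_prob_space_action G M act"
begin

lemma act_measurable [measurable]: "a \<in> carrier G \<Longrightarrow> act a \<in> M \<rightarrow>\<^sub>M M"
  using action by (simp add: standard_borel_prob_space_action_def)

text \<open>Invariance of the measure pulls null sets back to null sets, so an identity valid almost
  everywhere may also be used at the translated point.\<close>

lemma AE_act:
  assumes "a \<in> carrier G" "AE \<omega> in M. P \<omega>"
  shows "AE \<omega> in M. P (act a \<omega>)"
proof -
  have "distr M M (act a) = M"
    using action assms(1) by (simp add: standard_borel_prob_space_action_def)
  then show ?thesis using AE_distrD[OF act_measurable[OF assms(1)]] assms(2) by metis
qed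

lemma group_action: "group_action G (space M) act"
  using action by (simp add: standard_borel_prob_space_action_def)

lemma act_mult:
  "\<lbrakk>a \<in> carrier G; b \<in> carrier G; \<omega> \<in> space M\<rbrakk> \<Longrightarrow> act (a \<otimes> b) \<omega> = act a (act b \<omega>)"
  using group_action.composition_rule[OF group_action] .

lemma act_space: "\<lbrakk>a \<in> carrier G; \<omega> \<in> space M\<rbrakk> \<Longrightarrow> act a \<omega> \<in> space M"
  using measurable_space[OF act_measurable] .

lemma ess_bounded_int_act:
  assumes a: "a \<in> carrier G" and f: "f \<in> carrier (ess_bounded_int M)"
  shows "(\<lambda>\<omega>. f (act a \<omega>)) \<in> carrier (ess_bounded_int M)"
proof -
  obtain C where "AE \<omega> in M. \<bar>f \<omega>\<bar> \<le> C" using f by (auto simp: ess_bounded_int_simps)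
  then have "AE \<omega> in M. \<bar>f (act a \<omega>)\<bar> \<le> C" by (rule AE_act[OF a])
  then show ?thesis
    using measurable_compose[OF act_measurable[OF a]] f by (auto simp: ess_bounded_int_simps)
qed

text \<open>By invariance of the measure, translates of equivalent functions are equivalent, so
  every class in the union that defines the action is the same.\<close>

lemma Linf_class_act:
  assumes a: "a \<in> carrier G" and f: "f \<in> carrier (ess_bounded_int M)"
  shows "module_act (Linf_int_module G M act) a (Linf_class M f)
    = Linf_class M (\<lambda>\<omega>. f (act (inv a) \<omega>))"
proof -
  have "Linf_class M (\<lambda>\<omega>. h (act (inv a) \<omega>)) = Linf_class M (\<lambda>\<omega>. f (act (inv a) \<omega>))"
    if "h \<in> Linf_class M f" for h
  proof -
    have "h \<in> carrier (ess_bounded_int M)" "AE \<omega> in M. h \<omega> = f \<omega>"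
      using that f by (auto simp: Linf_class_eq)
    then show ?thesis using a f AE_act[of "inv a"] by (simp add: Linf_class_eq_iff ess_bounded_int_act)
  qed
  moreover have "f \<in> Linf_class M f" using f by (simp add: Linf_class_eq)
  ultimately have "(\<Union>h\<in>Linf_class M f. Linf_class M (\<lambda>\<omega>. h (act (inv a) \<omega>)))
      = Linf_class M (\<lambda>\<omega>. f (act (inv a) \<omega>))" by blast
  then show ?thesis by (simp add: Linf_int_module_def)
qed

sublocale Linf: isometric_module G "Linf_int_module G M act"
proof -
  let ?A = "Linf_int_module G M act"
  interpret A: comm_group ?A by (rule comm_group_Linf_int_module)
  show "isometric_module G ?A"
  proof unfold_locales
    fix g X assume g: "g \<in> carrier G" and X: "X \<in> carrier ?A"
    then obtain f where f: "f \<in> carrier (ess_bounded_int M)" and X_eq: "X = Linf_class M f"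
      by (auto simp: Linf_int_module_carrier)
    have fg: "(\<lambda>\<omega>. f (act (inv g) \<omega>)) \<in> carrier (ess_bounded_int M)"
      using ess_bounded_int_act f g by simp
    show "module_act ?A g X \<in> carrier ?A"
      using f g fg by (auto simp: X_eq Linf_class_act Linf_int_module_carrier)
    show "module_norm ?A (module_act ?A g X) \<le> module_norm ?A X"
      unfolding X_eq Linf_class_act[OF g f]
      by (rule Linf_norm_le[OF fg Linf_norm_nonneg_AE(1)[OF f]])
        (rule AE_act[OF inv_closed[OF g] Linf_norm_nonneg_AE(2)[OF f]])
    fix Y assume "Y \<in> carrier ?A"
    then obtain h where h: "h \<in> carrier (ess_bounded_int M)" and Y_eq: "Y = Linf_class M h"
      by (auto simp: Linf_int_module_carrier)
    show "module_act ?A g (X \<otimes>\<^bsub>?A\<^esub> Y) = module_act ?A g X \<otimes>\<^bsub>?A\<^esub> module_act ?A g Y"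
      using f g h by (simp add: X_eq Y_eq Linf_class_mult Linf_class_act ess_bounded_int_add ess_bounded_int_act)
  next
    fix X assume "X \<in> carrier ?A"
    then obtain f where f: "f \<in> carrier (ess_bounded_int M)" and X_eq: "X = Linf_class M f"
      by (auto simp: Linf_int_module_carrier)
    note N = Linf_norm_nonneg_AE[OF f, of G act]
    show "module_norm ?A (inv\<^bsub>?A\<^esub> X) \<le> module_norm ?A X"
      unfolding X_eq Linf_class_inv[OF f]
      using N by (intro Linf_norm_le ess_bounded_int_uminus f) auto
    fix Y assume "Y \<in> carrier ?A"
    then obtain h where h: "h \<in> carrier (ess_bounded_int M)" and Y_eq: "Y = Linf_class M h"
      by (auto simp: Linf_int_module_carrier)
    note N' = Linf_norm_nonneg_AE[OF h, of G act]
    have "AE \<omega> in M. real_of_int \<bar>f \<omega> + h \<omega>\<bar> \<le> module_norm ?A X + module_norm ?A Y"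
      using N(2) N'(2) unfolding X_eq Y_eq by eventually_elim linarith
    then show "module_norm ?A (X \<otimes>\<^bsub>?A\<^esub> Y) \<le> module_norm ?A X + module_norm ?A Y"
      using N(1) N'(1) unfolding X_eq Y_eq Linf_class_mult[OF f h]
      by (intro Linf_norm_le ess_bounded_int_add f h) auto
  qed
qed

text \<open>Reduces identities between cochains with values in classes to identities between
  representatives that hold almost everywhere.\<close>

lemma Linf_coboundary_1:
  assumes b: "\<forall>a\<in>carrier G. b a \<in> carrier (ess_bounded_int M)"
    and B: "\<forall>a\<in>carrier G. B [a] = Linf_class M (b a)"
    and ac: "a \<in> carrier G" "c \<in> carrier G"
  shows "(\<lambda>\<omega>. b c (act (inv a) \<omega>) - b (a \<otimes> c) \<omega> + b a \<omega>) \<in> carrier (ess_bounded_int M)"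
    and "coboundary 1 G (Linf_int_module G M act) B [a, c]
      = Linf_class M (\<lambda>\<omega>. b c (act (inv a) \<omega>) - b (a \<otimes> c) \<omega> + b a \<omega>)"
proof -
  have acc: "a \<otimes> c \<in> carrier G" using ac by simp
  have bac: "(\<lambda>\<omega>. b c (act (inv a) \<omega>)) \<in> carrier (ess_bounded_int M)"
    using b ac ess_bounded_int_act by simp
  have diff: "(\<lambda>\<omega>. b c (act (inv a) \<omega>) - b (a \<otimes> c) \<omega>) \<in> carrier (ess_bounded_int M)"
    using bac b acc by (simp add: ess_bounded_int_diff)
  then show "(\<lambda>\<omega>. b c (act (inv a) \<omega>) - b (a \<otimes> c) \<omega> + b a \<omega>) \<in> carrier (ess_bounded_int M)"
    using b ac(1) by (simp add: ess_bounded_int_add)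
  have "B \<in> tuples G 1 \<rightarrow> carrier (Linf_int_module G M act)"
    using b B by (auto simp: Linf_int_module_carrier tuples_1)
  from Linf.coboundary_1[OF this ac] show "coboundary 1 G (Linf_int_module G M act) B [a, c]
      = Linf_class M (\<lambda>\<omega>. b c (act (inv a) \<omega>) - b (a \<otimes> c) \<omega> + b a \<omega>)"
    using ac acc b bac diff ess_bounded_int_uminus[of "b (a \<otimes> c)"]
    by (simp add: B Linf_class_act Linf_class_inv Linf_class_mult)
qed

lemma Linf_cochain_1:
  assumes b: "\<And>a. a \<in> carrier G \<Longrightarrow> b a \<in> M \<rightarrow>\<^sub>M count_space UNIV"
    and C: "\<And>a. a \<in> carrier G \<Longrightarrow> AE \<omega> in M. real_of_int \<bar>b a \<omega>\<bar> \<le> C"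
  shows "(\<lambda>gs\<in>tuples G 1. Linf_class M (b (hd gs)))
    \<in> carrier (bounded_cochains 1 G (Linf_int_module G M act))"
proof -
  have ess: "b a \<in> carrier (ess_bounded_int M)" if "a \<in> carrier G" for a
    using that by (intro ess_bounded_intI[OF b C])
  \<comment> \<open>The norm is an infimum over nonnegative bounds, so \<open>C\<close> is replaced
    by its absolute value.\<close>
  have "AE \<omega> in M. real_of_int \<bar>b a \<omega>\<bar> \<le> \<bar>C\<bar>" if "a \<in> carrier G" for a
    using C[OF that] by eventually_elim linarith
  from Linf_norm_le[OF ess _ this]
  have "module_norm (Linf_int_module G M act) (Linf_class M (b a)) \<le> \<bar>C\<bar>" if "a \<in> carrier G" for a
    using that by simp
  then show ?thesis
    using ess by (auto simp: bounded_cochains_simps Linf_int_module_carrier tuples_1 intro!: exI[of _ "\<bar>C\<bar>"])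
qed

end


section \<open>The parametrized Euler class\<close>

text \<open>As the section of g starts in [0,1), applying the section of f to that value stays less
  than 1 above its own value at 0, hence in [0,2). Subtracting a number in [0,1) leaves an integer
  strictly between -1 and 2.\<close>

lemma euler_cocycle_bound:
  assumes f: "f \<in> carrier homeo_circle" and g: "g \<in> carrier homeo_circle"
  shows "\<bar>euler_cocycle [f, g]\<bar> \<le> 1"
proof -
  let ?fg = "f \<otimes>\<^bsub>homeo_circle\<^esub> g"
  have fg: "?fg \<in> carrier homeo_circle" using f g by simp
  have "euler_section f 0 \<le> euler_section f (euler_section g 0)"
    "euler_section f (euler_section g 0) < euler_section f (0 + 1)"
    using homeo_line_le_iff[OF euler_section(1)[OF f]] homeo_line_less_iff[OF euler_section(1)[OF f]]
      euler_section(3,4)[OF g] by simp_all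
  then have "real_of_int (euler_cocycle [f, g]) < 2" "- 1 < real_of_int (euler_cocycle [f, g])"
    unfolding euler_cocycle_eq[OF f g, of 0] homeo_lineD(3)[OF euler_section(1)[OF f]]
    using euler_section(3,4)[OF f] euler_section(3,4)[OF fg] by linarith+
  then show ?thesis by linarith
qed

lemma euler_cocycle_in_bounded_cochains:
  "euler_cocycle \<in> carrier (bounded_cochains 2 homeo_circle trivial_int_module)"
proof -
  have "\<bar>real_of_int (euler_cocycle gs)\<bar> \<le> 1" if "gs \<in> tuples homeo_circle 2" for gs
    using that euler_cocycle_bound by (auto simp: tuples_2) (metis of_int_1 of_int_abs of_int_le_iff)
  then show ?thesis
    by (auto simp: bounded_cochains_simps PiE_iff euler_cocycle_def[abs_def] simp del: of_int_abs
        simp flip: of_int_abs intro!: exI[of _ 1])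
qed

text \<open>Supplies the Borel maps from f to the pair of f and its i-th power, along which a Borel
  coboundary is averaged.\<close>

lemma homeo_circle_pow_measurable [measurable]:
  "(\<lambda>f. f [^]\<^bsub>homeo_circle\<^esub> (n::nat)) \<in> borel_homeo_circle \<rightarrow>\<^sub>M borel_homeo_circle"
proof (induction n)
  case (Suc n)
  then have [measurable]: "(\<lambda>f. f [^]\<^bsub>homeo_circle\<^esub> n) \<in> borel_homeo_circle \<rightarrow>\<^sub>M borel_homeo_circle" .
  show ?case unfolding homeo_circle.nat_pow_Suc by measurable
qed simp

lemma tendsto_bounded_div:
  fixes x :: "nat \<Rightarrow> real"
  assumes "\<And>n. \<bar>x n\<bar> \<le> C"
  shows "(\<lambda>n. x n / n) \<longlonglongrightarrow> 0"
proof (rule Lim_null_comparison)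
  show "\<forall>\<^sub>F n in sequentially. norm (x n / real n) \<le> C / n"
    using assms by (intro always_eventually) (simp add: divide_right_mono)
  show "(\<lambda>n. C / real n) \<longlonglongrightarrow> 0" by (rule lim_const_over_n)
qed

text \<open>Telescoping shows that \<open>\<beta> f\<close> is the limit of the averages over \<open>i\<close> of \<open>\<delta>\<beta> (f, f ^ i)\<close>.\<close>

lemma bounded_primitive_measurable:
  assumes \<beta>: "\<beta> \<in> carrier (bounded_cochains 1 homeo_circle trivial_int_module)"
    and meas: "borel_2_cochain (coboundary 1 homeo_circle trivial_int_module \<beta>)"
  shows "(\<lambda>f. \<beta> [f]) \<in> borel_homeo_circle \<rightarrow>\<^sub>M count_space UNIV"
proof -
  let ?c = "\<lambda>f g. coboundary 1 homeo_circle trivial_int_module \<beta> [f, g]"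
  obtain C where C: "\<And>f. f \<in> carrier homeo_circle \<Longrightarrow> \<bar>real_of_int (\<beta> [f])\<bar> \<le> C"
    using \<beta> by (fastforce simp: bounded_cochains_simps)
  have c: "?c f g = \<beta> [g] - \<beta> [f \<otimes>\<^bsub>homeo_circle\<^esub> g] + \<beta> [f]"
    if "f \<in> carrier homeo_circle" "g \<in> carrier homeo_circle" for f g
    using int_module.coboundary_1[of \<beta>, OF _ that] by simp
  have c_meas: "(\<lambda>f. real_of_int (?c f (f [^]\<^bsub>homeo_circle\<^esub> i))) \<in> borel_measurable borel_homeo_circle"
    for i :: nat
    using measurable_compose[OF measurable_compose[OF _ meas[unfolded borel_2_cochain_def],
        of "\<lambda>f. (f, f [^]\<^bsub>homeo_circle\<^esub> i)"], of _ real_of_int borel] by simp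
  have "(\<lambda>n::nat. (\<Sum>i<n. real_of_int (?c f (f [^]\<^bsub>homeo_circle\<^esub> (i::nat)))) / n) \<longlonglongrightarrow> real_of_int (\<beta> [f])"
    if f: "f \<in> carrier homeo_circle" for f
  proof -
    define x where "x n = real_of_int (\<beta> [f [^]\<^bsub>homeo_circle\<^esub> (n::nat)])" for n
    have sum: "(\<Sum>i<n. real_of_int (?c f (f [^]\<^bsub>homeo_circle\<^esub> i))) = x 0 - x n + n * real_of_int (\<beta> [f])"
      for n
    proof -
      have "real_of_int (?c f (f [^]\<^bsub>homeo_circle\<^esub> i)) = x i - x (Suc i) + real_of_int (\<beta> [f])" for i :: nat
        using c[OF f, of "f [^]\<^bsub>homeo_circle\<^esub> i"] homeo_circle.nat_pow_Suc2[OF f, of i] f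
        by (simp add: x_def)
      then show ?thesis by (simp add: sum.distrib sum_lessThan_telescope')
    qed
    have x: "\<bar>x n\<bar> \<le> C" for n using C f by (simp add: x_def)
    have "\<bar>x 0 - x n\<bar> \<le> 2 * C" for n using x[of 0] x[of n] by linarith
    then have "(\<lambda>n. (x 0 - x n) / n + real_of_int (\<beta> [f])) \<longlonglongrightarrow> 0 + real_of_int (\<beta> [f])"
      by (intro tendsto_add tendsto_bounded_div tendsto_const)
    \<comment> \<open>At n = 0 division by zero makes the average 0, so the two expressions are
      identified only for positive n.\<close>
    moreover have "\<forall>\<^sub>F n in sequentially. (x 0 - x n) / n + real_of_int (\<beta> [f])
        = (\<Sum>i<n. real_of_int (?c f (f [^]\<^bsub>homeo_circle\<^esub> i))) / n"
      using eventually_gt_at_top[of "0::nat"]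
      unfolding sum by eventually_elim (simp add: field_simps)
    ultimately show ?thesis by (simp add: filterlim_cong)
  qed
  note lim = this
  have "(\<lambda>f. real_of_int (\<beta> [f])) \<in> borel_measurable borel_homeo_circle"
  proof (rule borel_measurable_LIMSEQ_real)
    show "(\<lambda>n::nat. (\<Sum>i<n. real_of_int (?c f (f [^]\<^bsub>homeo_circle\<^esub> (i::nat)))) / n)
        \<longlonglongrightarrow> real_of_int (\<beta> [f])" if "f \<in> space borel_homeo_circle" for f
      using that lim by simp
    show "(\<lambda>f. (\<Sum>i<n. real_of_int (?c f (f [^]\<^bsub>homeo_circle\<^esub> (i::nat)))) / real n)
        \<in> borel_measurable borel_homeo_circle" for n
      by (intro borel_measurable_divide borel_measurable_sum borel_measurable_const c_meas)
  qed
  then have "(\<lambda>f. \<lfloor>real_of_int (\<beta> [f])\<rfloor>) \<in> borel_homeo_circle \<rightarrow>\<^sub>M count_space UNIV" by measurable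
  then show ?thesis by simp
qed

section \<open>Pulling cochains back along a measurable cocycle\<close>

locale circle_cocycle_action = prob_space_action G M act
  for G :: "('g, 'm) monoid_scheme" (structure) and M :: "'w measure" and act +
  fixes \<sigma> :: "'g \<times> 'w \<Rightarrow> complex \<Rightarrow> complex"
  assumes cocycle: "circle_cocycle G M act \<sigma>"
begin

lemma sigma_measurable:
  assumes "a \<in> carrier G"
  shows "(\<lambda>\<omega>. \<sigma> (a, \<omega>)) \<in> M \<rightarrow>\<^sub>M borel_homeo_circle"
proof -
  have "\<sigma> \<in> count_space (carrier G) \<Otimes>\<^sub>M M \<rightarrow>\<^sub>M borel_homeo_circle"
    using cocycle by (simp add: measurable_cocycle_def)
  moreover have "(\<lambda>\<omega>. (a, \<omega>)) \<in> M \<rightarrow>\<^sub>M count_space (carrier G) \<Otimes>\<^sub>M M"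
    using assms by (intro measurable_Pair1') simp
  ultimately show ?thesis by (rule measurable_compose[rotated])
qed

lemma sigma_carrier: "\<lbrakk>a \<in> carrier G; \<omega> \<in> space M\<rbrakk> \<Longrightarrow> \<sigma> (a, \<omega>) \<in> carrier homeo_circle"
  using measurable_space[OF sigma_measurable] by simp

lemma sigma_mult:
  "\<lbrakk>a \<in> carrier G; b \<in> carrier G\<rbrakk> \<Longrightarrow>
    AE \<omega> in M. \<sigma> (a \<otimes> b, \<omega>) = \<sigma> (a, act b \<omega>) \<otimes>\<^bsub>homeo_circle\<^esub> \<sigma> (b, \<omega>)"
  using cocycle by (simp add: measurable_cocycle_def)

text \<open>The homeomorphism \<open>\<tau> \<gamma> \<omega>\<close> maps the fibre over \<open>\<gamma>\<^sup>-\<^sup>1 \<omega>\<close> to the fibre over \<open>\<omega>\<close>. It is the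
  entry in the pullback of cochains, where the group acts on functions by \<open>\<gamma>\<^sup>-\<^sup>1\<close>.\<close>

definition \<tau> :: "'g \<Rightarrow> 'w \<Rightarrow> complex \<Rightarrow> complex" where
  "\<tau> a \<omega> = inv\<^bsub>homeo_circle\<^esub> \<sigma> (inv a, \<omega>)"

lemma tau_measurable [measurable]: "a \<in> carrier G \<Longrightarrow> \<tau> a \<in> M \<rightarrow>\<^sub>M borel_homeo_circle"
  unfolding \<tau>_def[abs_def] by (intro homeo_circle_inv_measurable sigma_measurable inv_closed)

lemma tau_carrier: "\<lbrakk>a \<in> carrier G; \<omega> \<in> space M\<rbrakk> \<Longrightarrow> \<tau> a \<omega> \<in> carrier homeo_circle"
  using measurable_space[OF tau_measurable] by simp

text \<open>Inverting the cocycle identity of \<open>\<sigma>\<close> at the inverses of b and a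
  reverses both the product in the group and the composition, so the factor of a comes first and
  that of b sits over the translated point, as in the coboundary.\<close>

lemma tau_mult:
  assumes a: "a \<in> carrier G" and b: "b \<in> carrier G"
  shows "AE \<omega> in M. \<tau> (a \<otimes> b) \<omega> = \<tau> a \<omega> \<otimes>\<^bsub>homeo_circle\<^esub> \<tau> b (act (inv a) \<omega>)"
  using sigma_mult[OF inv_closed[OF b] inv_closed[OF a]] AE_space
proof eventually_elim
  case (elim \<omega>)
  have "\<sigma> (inv b, act (inv a) \<omega>) \<in> carrier homeo_circle" "\<sigma> (inv a, \<omega>) \<in> carrier homeo_circle"
    using sigma_carrier act_space a b elim(2) by auto
  then show ?case using elim(1) a b by (simp add: \<tau>_def inv_mult_group homeo_circle.inv_mult_group)
qed

lemma pullback_cochain_apply: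
  assumes "a \<in> carrier G" "b \<in> carrier G"
  shows "pullback_cochain G M act \<sigma> \<psi> [a, b] = Linf_class M (\<lambda>\<omega>. \<psi> [\<tau> a \<omega>, \<tau> b (act (inv a) \<omega>)])"
  using assms by (simp add: pullback_cochain_def \<tau>_def)

lemma pullback_le:
  assumes "\<And>f g. \<lbrakk>f \<in> carrier homeo_circle; g \<in> carrier homeo_circle\<rbrakk> \<Longrightarrow> real_of_int \<bar>\<psi> [f, g]\<bar> \<le> C"
    and "a \<in> carrier G" "b \<in> carrier G"
  shows "AE \<omega> in M. real_of_int \<bar>\<psi> [\<tau> a \<omega>, \<tau> b (act (inv a) \<omega>)]\<bar> \<le> C"
  using assms by (intro AE_I2) (simp add: tau_carrier act_space)

lemma ess_bounded_int_pullback: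
  assumes \<psi>: "\<psi> \<in> carrier (bounded_cochains 2 homeo_circle trivial_int_module)" "borel_2_cochain \<psi>"
    and ab: "a \<in> carrier G" "b \<in> carrier G"
  shows "(\<lambda>\<omega>. \<psi> [\<tau> a \<omega>, \<tau> b (act (inv a) \<omega>)]) \<in> carrier (ess_bounded_int M)"
proof -
  obtain C where C: "\<And>f g. \<lbrakk>f \<in> carrier homeo_circle; g \<in> carrier homeo_circle\<rbrakk>
      \<Longrightarrow> real_of_int \<bar>\<psi> [f, g]\<bar> \<le> C"
    using \<psi>(1) by (fastforce simp: bounded_cochains_simps)
  have [measurable]: "(\<lambda>\<omega>. \<tau> b (act (inv a) \<omega>)) \<in> M \<rightarrow>\<^sub>M borel_homeo_circle"
    using ab by (intro measurable_compose[OF act_measurable tau_measurable]) auto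
  have [measurable]: "\<tau> a \<in> M \<rightarrow>\<^sub>M borel_homeo_circle" using ab by simp
  have "(\<lambda>\<omega>. \<psi> [\<tau> a \<omega>, \<tau> b (act (inv a) \<omega>)]) \<in> M \<rightarrow>\<^sub>M count_space UNIV"
    using measurable_compose[OF _ \<psi>(2)[unfolded borel_2_cochain_def],
        of "\<lambda>\<omega>. (\<tau> a \<omega>, \<tau> b (act (inv a) \<omega>))"] by simp
  then show ?thesis using pullback_le[where \<psi> = \<psi>, OF C ab] by (rule ess_bounded_intI)
qed

lemma pullback_in_bounded_cochains:
  assumes \<psi>: "\<psi> \<in> carrier (bounded_cochains 2 homeo_circle trivial_int_module)" "borel_2_cochain \<psi>"
  shows "pullback_cochain G M act \<sigma> \<psi> \<in> carrier (bounded_cochains 2 G (Linf_int_module G M act))"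
proof -
  let ?A = "Linf_int_module G M act" and ?p = "pullback_cochain G M act \<sigma> \<psi>"
  obtain C where "\<And>f g. \<lbrakk>f \<in> carrier homeo_circle; g \<in> carrier homeo_circle\<rbrakk>
      \<Longrightarrow> real_of_int \<bar>\<psi> [f, g]\<bar> \<le> C"
    using \<psi>(1) by (fastforce simp: bounded_cochains_simps)
  then have C: "\<And>f g. \<lbrakk>f \<in> carrier homeo_circle; g \<in> carrier homeo_circle\<rbrakk>
      \<Longrightarrow> real_of_int \<bar>\<psi> [f, g]\<bar> \<le> \<bar>C\<bar>"
    by (meson abs_ge_self order_trans)
  have "?p [a, b] \<in> carrier ?A" "module_norm ?A (?p [a, b]) \<le> \<bar>C\<bar>"
    if ab: "a \<in> carrier G" "b \<in> carrier G" for a b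
    unfolding pullback_cochain_apply[OF ab]
    using ess_bounded_int_pullback[OF \<psi> ab]
      Linf_norm_le[OF ess_bounded_int_pullback[OF \<psi> ab] abs_ge_zero pullback_le[where \<psi> = \<psi>, OF C ab]]
    by (simp_all add: Linf_int_module_carrier)
  moreover have "?p \<in> extensional (tuples G 2)" by (simp add: pullback_cochain_def)
  ultimately show ?thesis
    unfolding bounded_cochains_simps PiE_iff tuples_2 by (auto intro!: exI[of _ "\<bar>C\<bar>"])
qed

text \<open>Additivity is claimed for bounded Borel cochains, whose pullbacks are known to take
  values in the coefficient module.\<close>

lemma pullback_mult:
  assumes "\<psi> \<in> carrier (bounded_cochains 2 homeo_circle trivial_int_module)" "borel_2_cochain \<psi>"
    "\<psi>' \<in> carrier (bounded_cochains 2 homeo_circle trivial_int_module)" "borel_2_cochain \<psi>'"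
  shows "pullback_cochain G M act \<sigma> (\<psi> \<otimes>\<^bsub>bounded_cochains 2 homeo_circle trivial_int_module\<^esub> \<psi>')
    = pullback_cochain G M act \<sigma> \<psi> \<otimes>\<^bsub>bounded_cochains 2 G (Linf_int_module G M act)\<^esub>
      pullback_cochain G M act \<sigma> \<psi>'"
  (is "pullback_cochain G M act \<sigma> ?\<psi>\<psi>' = _")
proof -
  have *: "?\<psi>\<psi>' \<in> carrier (bounded_cochains 2 homeo_circle trivial_int_module)"
    using assms by (intro monoid.m_closed group.is_monoid int_module.group_bounded_cochains)
  have eq: "?\<psi>\<psi>' [f, g] = \<psi> [f, g] + \<psi>' [f, g]"
    if "f \<in> carrier homeo_circle" "g \<in> carrier homeo_circle" for f g
    using that by (simp add: bounded_cochains_simps)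
  have "borel_2_cochain ?\<psi>\<psi>'"
  proof -
    note assms(2,4)[unfolded borel_2_cochain_def, measurable]
    have "(\<lambda>x. (case x of (f, g) \<Rightarrow> \<psi> [f, g]) + (case x of (f, g) \<Rightarrow> \<psi>' [f, g]))
        \<in> borel_homeo_circle \<Otimes>\<^sub>M borel_homeo_circle \<rightarrow>\<^sub>M count_space UNIV" by measurable
    then show ?thesis
      unfolding borel_2_cochain_def
      by (rule measurable_cong[THEN iffD1, rotated]) (auto simp: space_pair_measure eq)
  qed
  show ?thesis
    unfolding bounded_cochains_simps(2)[where G = G]
  proof (rule extensionalityI)
    fix gs assume "gs \<in> tuples G 2"
    then obtain a b where gs: "gs = [a, b]" and ab: "a \<in> carrier G" "b \<in> carrier G"
      by (auto simp: tuples_2)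
    have e: "(\<lambda>\<omega>. \<psi> [\<tau> a \<omega>, \<tau> b (act (inv a) \<omega>)]) \<in> carrier (ess_bounded_int M)"
      "(\<lambda>\<omega>. \<psi>' [\<tau> a \<omega>, \<tau> b (act (inv a) \<omega>)]) \<in> carrier (ess_bounded_int M)"
      "(\<lambda>\<omega>. ?\<psi>\<psi>' [\<tau> a \<omega>, \<tau> b (act (inv a) \<omega>)]) \<in> carrier (ess_bounded_int M)"
      using ess_bounded_int_pullback[OF assms(1,2) ab] ess_bounded_int_pullback[OF assms(3,4) ab]
        ess_bounded_int_pullback[OF * \<open>borel_2_cochain ?\<psi>\<psi>'\<close> ab] by simp_all
    have "AE \<omega> in M. ?\<psi>\<psi>' [\<tau> a \<omega>, \<tau> b (act (inv a) \<omega>)]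
        = \<psi> [\<tau> a \<omega>, \<tau> b (act (inv a) \<omega>)] + \<psi>' [\<tau> a \<omega>, \<tau> b (act (inv a) \<omega>)]"
      by (intro AE_I2 eq) (use ab in \<open>auto simp: tau_carrier act_space\<close>)
    then show "pullback_cochain G M act \<sigma> ?\<psi>\<psi>' gs = (\<lambda>gs\<in>tuples G 2.
        pullback_cochain G M act \<sigma> \<psi> gs \<otimes>\<^bsub>Linf_int_module G M act\<^esub> pullback_cochain G M act \<sigma> \<psi>' gs) gs"
      using ab e by (simp add: gs pullback_cochain_apply Linf_class_mult Linf_class_eq_iff ess_bounded_int_add)
  qed (simp_all add: pullback_cochain_def)
qed

text \<open>A bounded primitive of a Borel coboundary is Borel, so composing it with
  \<open>\<tau>\<close> gives an admissible cochain of degree one; \<open>tau_mult\<close>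
  identifies its coboundary with the pullback.\<close>

lemma pullback_coboundary:
  assumes \<psi>: "\<psi> \<in> bounded_coboundaries 2 homeo_circle trivial_int_module" "borel_2_cochain \<psi>"
  shows "pullback_cochain G M act \<sigma> \<psi> \<in> bounded_coboundaries 2 G (Linf_int_module G M act)"
proof -
  let ?A = "Linf_int_module G M act"
  obtain \<beta> where \<beta>: "\<beta> \<in> carrier (bounded_cochains 1 homeo_circle trivial_int_module)"
    and \<psi>_eq: "\<psi> = coboundary 1 homeo_circle trivial_int_module \<beta>"
    using \<psi>(1) by (auto simp: bounded_coboundaries_2)
  have \<psi>_carrier: "\<psi> \<in> carrier (bounded_cochains 2 homeo_circle trivial_int_module)"
    using subgroup.mem_carrier[OF int_module.subgroup_bounded_coboundaries_2 \<psi>(1)] .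
  note \<beta>_meas[measurable] = bounded_primitive_measurable[OF \<beta> \<psi>(2)[unfolded \<psi>_eq]]
  obtain C where C: "\<And>f. f \<in> carrier homeo_circle \<Longrightarrow> real_of_int \<bar>\<beta> [f]\<bar> \<le> C"
    using \<beta> by (fastforce simp: bounded_cochains_simps)
  define b where "b a \<omega> = \<beta> [\<tau> a \<omega>]" for a \<omega>
  have b: "b a \<in> M \<rightarrow>\<^sub>M count_space UNIV" if "a \<in> carrier G" for a
    unfolding b_def[abs_def] by (rule measurable_compose[OF tau_measurable[OF that] \<beta>_meas])
  have b_le: "AE \<omega> in M. real_of_int \<bar>b a \<omega>\<bar> \<le> C" if "a \<in> carrier G" for a
    using C[OF tau_carrier[OF that]] by (intro AE_I2) (simp add: b_def)
  have ess: "\<forall>a\<in>carrier G. b a \<in> carrier (ess_bounded_int M)"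
    by (intro ballI ess_bounded_intI[OF b b_le])
  define B where "B = (\<lambda>gs\<in>tuples G 1. Linf_class M (b (hd gs)))"
  have B: "\<forall>a\<in>carrier G. B [a] = Linf_class M (b a)"
    by (simp add: B_def)
  have "B \<in> carrier (bounded_cochains 1 G ?A)"
    unfolding B_def by (rule Linf_cochain_1[OF b b_le])
  moreover have "pullback_cochain G M act \<sigma> \<psi> = coboundary 1 G ?A B"
  proof (rule extensionalityI)
    show "coboundary 1 G ?A B \<in> extensional (tuples G 2)"
      using Linf.coboundary_extensional[of 1] by (simp add: numeral_2_eq_2)
  next
    fix gs assume "gs \<in> tuples G 2"
    then obtain a c where gs: "gs = [a, c]" and ac: "a \<in> carrier G" "c \<in> carrier G"
      by (auto simp: tuples_2)
    have "(\<lambda>\<omega>. \<psi> [\<tau> a \<omega>, \<tau> c (act (inv a) \<omega>)]) \<in> carrier (ess_bounded_int M)"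
      by (rule ess_bounded_int_pullback[OF \<psi>_carrier \<psi>(2) ac])
    moreover have "AE \<omega> in M. \<psi> [\<tau> a \<omega>, \<tau> c (act (inv a) \<omega>)]
        = b c (act (inv a) \<omega>) - b (a \<otimes> c) \<omega> + b a \<omega>"
      using tau_mult[OF ac] AE_space
    proof eventually_elim
      case (elim \<omega>)
      have "\<tau> a \<omega> \<in> carrier homeo_circle" "\<tau> c (act (inv a) \<omega>) \<in> carrier homeo_circle"
        using ac elim(2) by (auto intro!: tau_carrier act_space)
      from int_module.coboundary_1[of \<beta>, OF _ this] show ?case
        unfolding \<psi>_eq by (simp add: b_def elim(1))
    qed
    ultimately show "pullback_cochain G M act \<sigma> \<psi> gs = coboundary 1 G ?A B gs"
      unfolding gs pullback_cochain_apply[OF ac] Linf_coboundary_1(2)[OF ess B ac]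
      using Linf_coboundary_1(1)[OF ess B ac] by (simp only: Linf_class_eq_iff)
  qed (simp add: pullback_cochain_def)
  ultimately show ?thesis by (auto simp: bounded_coboundaries_2)
qed

text \<open>\<open>the_elem\<close> is applied to a singleton: the Euler cocycle is a Borel
  representative, and any other one differs from it by a Borel coboundary, whose pullback is a
  coboundary.\<close>

lemma parametrized_euler_class_eq:
  "parametrized_euler_class G M act \<sigma>
    = bounded_class 2 G (Linf_int_module G M act) (pullback_cochain G M act \<sigma> euler_cocycle)"
proof -
  let ?A = "Linf_int_module G M act"
  let ?Z = "trivial_int_module :: (int, complex \<Rightarrow> complex) normed_module"
  let ?C = "bounded_cochains 2 homeo_circle ?Z"
  note eul = euler_cocycle_in_bounded_cochains borel_2_cochain_euler_cocycle
  interpret C: comm_group ?C by (rule int_module.comm_group_bounded_cochains)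
  note B = int_module.subgroup_bounded_coboundaries_2
  have bec: "bounded_euler_class = bounded_coboundaries 2 homeo_circle ?Z #>\<^bsub>?C\<^esub> euler_cocycle"
    by (simp add: bounded_euler_class_def bounded_class_eq_r_coset)
  have "euler_cocycle \<in> bounded_euler_class"
    unfolding bec using C.rcos_self[OF eul(1) B] .
  moreover have "bounded_class 2 G ?A (pullback_cochain G M act \<sigma> \<psi>)
      = bounded_class 2 G ?A (pullback_cochain G M act \<sigma> euler_cocycle)"
    if \<psi>: "\<psi> \<in> bounded_euler_class" "borel_2_cochain \<psi>" for \<psi>
  proof -
    obtain b where b: "b \<in> bounded_coboundaries 2 homeo_circle ?Z" and \<psi>_eq: "\<psi> = b \<otimes>\<^bsub>?C\<^esub> euler_cocycle"
      using \<psi>(1) by (auto simp: bec r_coset_def)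
    have bC: "b \<in> carrier ?C" using subgroup.mem_carrier[OF B b] .
    have eq: "b [f, g] = \<psi> [f, g] - euler_cocycle [f, g]"
      if "f \<in> carrier homeo_circle" "g \<in> carrier homeo_circle" for f g
      using that by (simp add: \<psi>_eq bounded_cochains_simps)
    have "borel_2_cochain b"
    proof -
      note \<psi>(2)[unfolded borel_2_cochain_def, measurable] eul(2)[unfolded borel_2_cochain_def, measurable]
      have "(\<lambda>x. (case x of (f, g) \<Rightarrow> \<psi> [f, g]) - (case x of (f, g) \<Rightarrow> euler_cocycle [f, g]))
          \<in> borel_homeo_circle \<Otimes>\<^sub>M borel_homeo_circle \<rightarrow>\<^sub>M count_space UNIV" by measurable
      then show ?thesis
        unfolding borel_2_cochain_def
        by (rule measurable_cong[THEN iffD1, rotated]) (auto simp: space_pair_measure eq)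
    qed
    then show ?thesis
      unfolding \<psi>_eq pullback_mult[OF bC \<open>borel_2_cochain b\<close> eul]
      using b by (intro Linf.bounded_class_2_mult_coboundary pullback_in_bounded_cochains
          pullback_coboundary eul)
  qed
  ultimately have "(\<lambda>\<psi>. bounded_class 2 G ?A (pullback_cochain G M act \<sigma> \<psi>))
      ` {\<psi> \<in> bounded_euler_class. borel_2_cochain \<psi>}
      = {bounded_class 2 G ?A (pullback_cochain G M act \<sigma> euler_cocycle)}"
    using eul(2) by blast
  then show ?thesis by (simp add: parametrized_euler_class_def bounded_pullback_def)
qed

text \<open>Trades classes for functions by choosing a representative of the primitive at each group
  element. The single constant \<open>C\<close>, valid for all elements at once, is the boundedness
  of the primitive.\<close>

lemma parametrized_euler_class_vanishes_iff:
  "parametrized_euler_class G M act \<sigma> = \<one>\<^bsub>bounded_cohomology 2 G (Linf_int_module G M act)\<^esub> \<longleftrightarrow>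
    (\<exists>b C. (\<forall>a\<in>carrier G. b a \<in> M \<rightarrow>\<^sub>M count_space UNIV \<and> (AE \<omega> in M. real_of_int \<bar>b a \<omega>\<bar> \<le> C)) \<and>
       (\<forall>a\<in>carrier G. \<forall>c\<in>carrier G. AE \<omega> in M.
          euler_cocycle [\<tau> a \<omega>, \<tau> c (act (inv a) \<omega>)]
            = b c (act (inv a) \<omega>) - b (a \<otimes> c) \<omega> + b a \<omega>))"
  (is "?vanishes \<longleftrightarrow> ?primitive")
proof -
  let ?A = "Linf_int_module G M act"
  note eul = euler_cocycle_in_bounded_cochains borel_2_cochain_euler_cocycle
  let ?p = "pullback_cochain G M act \<sigma> euler_cocycle"
  have coboundary: "coboundary 1 G ?A B [a, c] = ?p [a, c] \<longleftrightarrow>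
      (AE \<omega> in M. euler_cocycle [\<tau> a \<omega>, \<tau> c (act (inv a) \<omega>)]
        = b c (act (inv a) \<omega>) - b (a \<otimes> c) \<omega> + b a \<omega>)"
    if B: "\<forall>a\<in>carrier G. B [a] = Linf_class M (b a)"
      and b: "\<forall>a\<in>carrier G. b a \<in> carrier (ess_bounded_int M)"
      and ac: "a \<in> carrier G" "c \<in> carrier G" for B b a c
  proof -
    have "(\<lambda>\<omega>. euler_cocycle [\<tau> a \<omega>, \<tau> c (act (inv a) \<omega>)]) \<in> carrier (ess_bounded_int M)"
      by (rule ess_bounded_int_pullback[OF eul ac])
    then show ?thesis
      unfolding pullback_cochain_apply[OF ac] Linf_coboundary_1(2)[OF b B ac]
      using Linf_coboundary_1(1)[OF b B ac]
      by (simp only: Linf_class_eq_iff eq_commute)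
  qed
  have "?vanishes \<longleftrightarrow> ?p \<in> bounded_coboundaries 2 G ?A"
    unfolding parametrized_euler_class_eq
    by (rule Linf.bounded_class_2_eq_one_iff[OF pullback_in_bounded_cochains[OF eul]])
  also have "\<dots> \<longleftrightarrow> ?primitive"
  proof
    assume "?p \<in> bounded_coboundaries 2 G ?A"
    then obtain B where B: "B \<in> carrier (bounded_cochains 1 G ?A)" and p: "?p = coboundary 1 G ?A B"
      by (auto simp: bounded_coboundaries_2)
    then obtain C where C: "\<And>a. a \<in> carrier G \<Longrightarrow> module_norm ?A (B [a]) \<le> C"
      by (fastforce simp: bounded_cochains_simps)
    have "\<forall>a\<in>carrier G. \<exists>b. b \<in> carrier (ess_bounded_int M) \<and> B [a] = Linf_class M b"
      using B by (fastforce simp: bounded_cochains_simps Linf_int_module_carrier)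
    from bchoice[OF this] obtain b
      where b: "\<forall>a\<in>carrier G. b a \<in> carrier (ess_bounded_int M) \<and> B [a] = Linf_class M (b a)" ..
    then have ess: "\<forall>a\<in>carrier G. b a \<in> carrier (ess_bounded_int M)"
      and B_eq: "\<forall>a\<in>carrier G. B [a] = Linf_class M (b a)" by auto
    have "AE \<omega> in M. real_of_int \<bar>b a \<omega>\<bar> \<le> C" if a: "a \<in> carrier G" for a
    proof -
      have "module_norm ?A (Linf_class M (b a)) \<le> C" using C[OF a] B_eq a by simp
      moreover have "AE \<omega> in M. real_of_int \<bar>b a \<omega>\<bar> \<le> module_norm ?A (Linf_class M (b a))"
        using ess a by (intro Linf_norm_nonneg_AE(2)) simp
      ultimately show ?thesis by (auto elim: eventually_mono)
    qed
    then show ?primitive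
      using ess coboundary[OF B_eq ess] p
      by (intro exI[of _ b] exI[of _ C]) (simp add: ess_bounded_int_measurable)
  next
    assume ?primitive
    then obtain b C where b: "\<And>a. a \<in> carrier G \<Longrightarrow> b a \<in> M \<rightarrow>\<^sub>M count_space UNIV"
      "\<And>a. a \<in> carrier G \<Longrightarrow> AE \<omega> in M. real_of_int \<bar>b a \<omega>\<bar> \<le> C"
      and eq: "\<And>a c. \<lbrakk>a \<in> carrier G; c \<in> carrier G\<rbrakk> \<Longrightarrow> AE \<omega> in M.
          euler_cocycle [\<tau> a \<omega>, \<tau> c (act (inv a) \<omega>)]
            = b c (act (inv a) \<omega>) - b (a \<otimes> c) \<omega> + b a \<omega>"
      by blast
    have ess: "\<forall>a\<in>carrier G. b a \<in> carrier (ess_bounded_int M)"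
      by (intro ballI ess_bounded_intI[OF b])
    define B where "B = (\<lambda>gs\<in>tuples G 1. Linf_class M (b (hd gs)))"
    have B: "\<forall>a\<in>carrier G. B [a] = Linf_class M (b a)" by (simp add: B_def)
    have "B \<in> carrier (bounded_cochains 1 G ?A)"
      unfolding B_def by (rule Linf_cochain_1[OF b])
    moreover have "?p = coboundary 1 G ?A B"
    proof (rule extensionalityI)
      show "coboundary 1 G ?A B \<in> extensional (tuples G 2)"
        using Linf.coboundary_extensional[of 1] by (simp add: numeral_2_eq_2)
      show "?p gs = coboundary 1 G ?A B gs" if "gs \<in> tuples G 2" for gs
      proof -
        obtain a c where gs: "gs = [a, c]" and ac: "a \<in> carrier G" "c \<in> carrier G"
          using \<open>gs \<in> tuples G 2\<close> by (auto simp: tuples_2)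
        show ?thesis using coboundary[OF B ess ac] eq[OF ac] unfolding gs by simp
      qed
    qed (simp add: pullback_cochain_def)
    ultimately show "?p \<in> bounded_coboundaries 2 G ?A" by (auto simp: bounded_coboundaries_2)
  qed
  finally show ?thesis .
qed

end


section \<open>Lifts, equivariant families and semicohomology\<close>

text \<open>Each generated element is the product of a finite word in \<open>S\<close> and inverses
  of members of \<open>S\<close>, and finite words over a countable alphabet are countable.\<close>

lemma (in group) countable_generate:
  assumes S: "countable S" "S \<subseteq> carrier G"
  shows "countable (generate G S)"
proof -
  define T where "T = S \<union> m_inv G ` S"
  define p where "p xs = foldr (\<otimes>) xs \<one>" for xs
  have T: "T \<subseteq> carrier G" using S(2) by (auto simp: T_def)
  have closed: "p xs \<in> carrier G" if "xs \<in> lists T" for xs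
    using that T by (induction xs) (auto simp: p_def)
  have append: "p (xs @ ys) = p xs \<otimes> p ys" if "xs \<in> lists T" "ys \<in> lists T" for xs ys
    using that(1)
  proof (induction xs)
    case Nil
    then show ?case using closed[OF that(2)] by (simp add: p_def)
  next
    case (Cons x xs)
    then show ?case
      using closed[OF Cons(2)] closed[OF that(2)] T by (simp add: p_def m_assoc subset_iff)
  qed
  have single: "p [x] = x" if "x \<in> T" for x using that T by (auto simp: p_def)
  have "x \<in> p ` lists T" if "x \<in> generate G S" for x
    using that
  proof induction
    case one
    have "p [] = \<one>" by (simp add: p_def)
    then show ?case by (metis image_eqI lists.Nil)
  next
    case (incl h)
    then have "h \<in> T" by (simp add: T_def)
    then show ?case using single by (intro image_eqI[of _ _ "[h]"]) auto
  next
    case (inv h)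
    then have "inv h \<in> T" by (simp add: T_def)
    then show ?case using single by (intro image_eqI[of _ _ "[inv h]"]) auto
  next
    case (eng h1 h2)
    then obtain xs ys where "xs \<in> lists T" "ys \<in> lists T" "h1 = p xs" "h2 = p ys" by blast
    then show ?case using append by (intro image_eqI[of _ _ "xs @ ys"]) auto
  qed
  then have "generate G S \<subseteq> p ` lists T" by blast
  moreover have "countable (p ` lists T)" using S(1) by (simp add: T_def)
  ultimately show ?thesis by (rule countable_subset)
qed

lemma bounded_essential_image:
  assumes "closed K" "bounded K" and "\<And>\<omega>. \<omega> \<in> space M \<Longrightarrow> r \<omega> \<in> K"
  shows "bounded (essential_image M r)"
proof -
  have "x \<in> K" if "x \<in> essential_image M r" for x
  proof (rule ccontr)
    assume "x \<notin> K"
    then have "emeasure M (r -` (- K) \<inter> space M) > 0"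
      using that assms(1) by (auto simp: essential_image_def open_closed)
    moreover have "r -` (- K) \<inter> space M = {}" using assms(3) by auto
    ultimately show False by simp
  qed
  then show ?thesis using assms(2) bounded_subset by blast
qed

lemma nondecreasing_degree_one_const:
  assumes "z \<in> circle"
  shows "nondecreasing_degree_one (\<lambda>_. z)"
proof -
  have "weakly_cyclically_ordered (map (\<lambda>_. z) zs)" for zs :: "complex list"
    unfolding weakly_cyclically_ordered_def
    by (rule exI[of _ "replicate (length zs) (circle_arg z)"])
      (auto simp: circle_proj_circle_arg[OF assms] map_replicate_const)
  then show ?thesis using assms by (simp add: nondecreasing_degree_one_def)
qed

section \<open>The implications between the four conditions\<close>

context circle_cocycle_action
begin

text \<open>From (2) to (3): \<open>circle_proj\<close> intertwines the lift with its projection,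
  fibre by fibre.\<close>

lemma equivariant_line_family_imp_circle:
  assumes \<sigma>': "line_cocycle G M act \<sigma>'" and lift: "lift_of_cocycle G M \<sigma>' \<sigma>"
    and r: "equivariant_family G M act borel \<sigma>' r"
  shows "equivariant_family G M act circle_borel \<sigma> (\<lambda>\<omega>. circle_proj (r \<omega>))"
  unfolding equivariant_family_def
proof (intro conjI ballI)
  have [measurable]: "r \<in> borel_measurable M" using r by (simp add: equivariant_family_def)
  show "(\<lambda>\<omega>. circle_proj (r \<omega>)) \<in> M \<rightarrow>\<^sub>M circle_borel"
    by (intro measurable_restrict_space2) auto
  fix a assume a: "a \<in> carrier G"
  have "\<sigma>' \<in> count_space (carrier G) \<Otimes>\<^sub>M M \<rightarrow>\<^sub>M borel_homeo_line"
    using \<sigma>' by (simp add: measurable_cocycle_def)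
  from measurable_space[OF this] have carrier: "\<sigma>' (a, \<omega>) \<in> carrier homeo_line" if "\<omega> \<in> space M" for \<omega>
    using a that by (simp add: space_pair_measure)
  have "AE \<omega> in M. homeo_proj (\<sigma>' (a, \<omega>)) = \<sigma> (a, \<omega>)" "AE \<omega> in M. r (act a \<omega>) = \<sigma>' (a, \<omega>) (r \<omega>)"
    using lift r a by (auto simp: lift_of_cocycle_def equivariant_family_def)
  then show "AE \<omega> in M. circle_proj (r (act a \<omega>)) = \<sigma> (a, \<omega>) (circle_proj (r \<omega>))"
    using AE_space
  proof eventually_elim
    case (elim \<omega>)
    then show ?case using homeo_proj_circle_proj[OF carrier[OF elim(3)], of "r \<omega>"] by simp
  qed
qed

text \<open>From (3) to (1). The section of \<open>\<tau> a \<omega>\<close> carries the normalised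
  lift \<open>l\<close> of one point of the family to a lift of another; the integer by which it
  misses the normalised one is the primitive.\<close>

lemma equivariant_circle_family_imp_vanishing:
  assumes "equivariant_family G M act circle_borel \<sigma> r"
  shows "parametrized_euler_class G M act \<sigma> = \<one>\<^bsub>bounded_cohomology 2 G (Linf_int_module G M act)\<^esub>"
proof -
  have r_meas: "r \<in> M \<rightarrow>\<^sub>M circle_borel"
    and r_eq: "\<And>a. a \<in> carrier G \<Longrightarrow> AE \<omega> in M. r (act a \<omega>) = \<sigma> (a, \<omega>) (r \<omega>)"
    using assms by (auto simp: equivariant_family_def)
  have r_circle: "r \<omega> \<in> circle" if "\<omega> \<in> space M" for \<omega>
    using measurable_space[OF r_meas that] by (simp add: space_restrict_space)
  have [measurable]: "r \<in> borel_measurable M"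
    using r_meas by (auto simp: measurable_restrict_space2_iff)
  define l where "l \<omega> = circle_arg (r \<omega>)" for \<omega>
  have l_meas[measurable]: "l \<in> borel_measurable M" unfolding l_def[abs_def] by measurable
  have l: "0 \<le> l \<omega>" "l \<omega> < 1" for \<omega> by (simp_all add: l_def circle_arg_ge_0 circle_arg_lt_1)
  \<comment> \<open>Equivariance makes the difference an integer only almost everywhere; the floor
    gives a measurable integer for every \<open>\<omega>\<close>.\<close>
  define b where "b a \<omega> = \<lfloor>euler_section (\<tau> a \<omega>) (l (act (inv a) \<omega>)) - l \<omega>\<rfloor>" for a \<omega>
  have b_eq: "AE \<omega> in M. euler_section (\<tau> a \<omega>) (l (act (inv a) \<omega>)) = l \<omega> + b a \<omega>"
    if a: "a \<in> carrier G" for a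
    using r_eq[OF inv_closed[OF a]] AE_space
  proof eventually_elim
    case (elim \<omega>)
    have \<sigma>: "\<sigma> (inv a, \<omega>) \<in> carrier homeo_circle" using sigma_carrier a elim(2) by simp
    have "circle_proj (euler_section (\<tau> a \<omega>) (l (act (inv a) \<omega>))) = \<tau> a \<omega> (r (act (inv a) \<omega>))"
      using circle_proj_circle_arg[OF r_circle[OF act_space[OF inv_closed[OF a] elim(2)]]]
      by (simp add: circle_proj_euler_section tau_carrier a elim(2) l_def)
    also have "\<dots> = r \<omega>"
      using homeo_circle_inv_eq(2)[OF \<sigma> r_circle[OF elim(2)]] by (simp add: elim(1) \<tau>_def)
    also have "\<dots> = circle_proj (l \<omega>)"
      using circle_proj_circle_arg[OF r_circle[OF elim(2)]] by (simp add: l_def)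
    finally have "euler_section (\<tau> a \<omega>) (l (act (inv a) \<omega>)) - l \<omega> \<in> \<int>" by (simp add: circle_proj_eq_iff)
    then show ?case by (auto simp: b_def elim: Ints_cases)
  qed
  have "b a \<in> M \<rightarrow>\<^sub>M count_space UNIV" if a: "a \<in> carrier G" for a
  proof -
    have [measurable]: "\<tau> a \<in> M \<rightarrow>\<^sub>M borel_homeo_circle" "act (inv a) \<in> M \<rightarrow>\<^sub>M M" using a by auto
    have [measurable]: "(\<lambda>\<omega>. euler_section (\<tau> a \<omega>) (l (act (inv a) \<omega>))) \<in> borel_measurable M"
      by (rule homeo_line_apply_measurable) measurable
    show ?thesis unfolding b_def[abs_def] by measurable
  qed
  \<comment> \<open>The section maps [0,1) into [0,2) and \<open>l\<close> lies in [0,1), so the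
    difference under the floor lies strictly between -1 and 2, even where it is not an
    integer.\<close>
  moreover have "AE \<omega> in M. real_of_int \<bar>b a \<omega>\<bar> \<le> 2" if a: "a \<in> carrier G" for a
  proof (rule AE_I2)
    fix \<omega> assume \<omega>: "\<omega> \<in> space M"
    let ?F = "euler_section (\<tau> a \<omega>)" and ?x = "l (act (inv a) \<omega>)"
    note s = euler_section[OF tau_carrier[OF a \<omega>]]
    have "?F 0 \<le> ?F ?x" "?F ?x < ?F (0 + 1)"
      using l[of "act (inv a) \<omega>"] homeo_line_le_iff[OF s(1)] homeo_line_less_iff[OF s(1)] by simp_all
    then have "- 1 < ?F ?x - l \<omega>" "?F ?x - l \<omega> < 2"
      using s(3,4) l[of \<omega>] unfolding homeo_lineD(3)[OF s(1)] by linarith+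
    then show "real_of_int \<bar>b a \<omega>\<bar> \<le> 2" unfolding b_def by linarith
  qed
  moreover have "AE \<omega> in M. euler_cocycle [\<tau> a \<omega>, \<tau> c (act (inv a) \<omega>)]
      = b c (act (inv a) \<omega>) - b (a \<otimes> c) \<omega> + b a \<omega>" if a: "a \<in> carrier G" and c: "c \<in> carrier G" for a c
    using AE_act[OF inv_closed[OF a] b_eq[OF c]] b_eq[OF a] b_eq[OF m_closed[OF a c]] tau_mult[OF a c] AE_space
  proof eventually_elim
    case (elim \<omega>)
    let ?\<omega> = "act (inv a) \<omega>"
    have carrier: "\<tau> a \<omega> \<in> carrier homeo_circle" "\<tau> c ?\<omega> \<in> carrier homeo_circle"
      using a c elim(5) by (auto intro!: tau_carrier act_space)
    have act: "act (inv (a \<otimes> c)) \<omega> = act (inv c) ?\<omega>"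
      using a c elim(5) by (simp add: inv_mult_group act_mult)
    \<comment> \<open>The free point of \<open>euler_cocycle_eq\<close> is taken to be the
      normalised lift over the translate by the inverse of the product. Each of the three sections
      then maps such a lift to another one plus a value of \<open>b\<close>.\<close>
    have "real_of_int (euler_cocycle [\<tau> a \<omega>, \<tau> c ?\<omega>])
        = euler_section (\<tau> a \<omega>) (euler_section (\<tau> c ?\<omega>) (l (act (inv c) ?\<omega>)))
          - euler_section (\<tau> (a \<otimes> c) \<omega>) (l (act (inv (a \<otimes> c)) \<omega>))"
      unfolding elim(4) act by (rule euler_cocycle_eq[OF carrier])
    also have "\<dots> = b c ?\<omega> - b (a \<otimes> c) \<omega> + b a \<omega>"
      unfolding elim(1,3) homeo_lineD(4)[OF euler_section(1)[OF carrier(1)]] elim(2) by simp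
    finally show ?case by linarith
  qed
  ultimately show ?thesis
    unfolding parametrized_euler_class_vanishes_iff by (intro exI[of _ b] exI[of _ 2]) blast
qed

text \<open>From (1) to (2): the primitive corrects the section to a lift that is multiplicative
  almost everywhere, and the supremum of the orbit of 0 is the required family.\<close>

lemma vanishing_imp_bounded_lift:
  assumes fg: "finitely_generated G"
    and "parametrized_euler_class G M act \<sigma> = \<one>\<^bsub>bounded_cohomology 2 G (Linf_int_module G M act)\<^esub>"
  shows "\<exists>\<sigma>'. line_cocycle G M act \<sigma>' \<and> lift_of_cocycle G M \<sigma>' \<sigma> \<and>
    (\<exists>r. equivariant_family G M act borel \<sigma>' r \<and> bounded (essential_image M r))"
proof -
  obtain S where "finite S" "S \<subseteq> carrier G" "generate G S = carrier G"
    using fg by (auto simp: finitely_generated_def)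
  then have countable: "countable (carrier G)" using countable_generate[of S] by (simp add: countable_finite)
  obtain b C where b: "\<And>a. a \<in> carrier G \<Longrightarrow> b a \<in> M \<rightarrow>\<^sub>M count_space UNIV"
    and C: "\<And>a. a \<in> carrier G \<Longrightarrow> AE \<omega> in M. real_of_int \<bar>b a \<omega>\<bar> \<le> C"
    and eul: "\<And>a c. \<lbrakk>a \<in> carrier G; c \<in> carrier G\<rbrakk> \<Longrightarrow> AE \<omega> in M.
      euler_cocycle [\<tau> a \<omega>, \<tau> c (act (inv a) \<omega>)] = b c (act (inv a) \<omega>) - b (a \<otimes> c) \<omega> + b a \<omega>"
    using assms(2) unfolding parametrized_euler_class_vanishes_iff by blast
  \<comment> \<open>Subtracting the primitive cancels the Euler cocycle, which is the defect of the
    section from satisfying the identity of \<open>tau_mult\<close>.\<close>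
  define F where "F a \<omega> = (\<lambda>x. euler_section (\<tau> a \<omega>) x + of_int (- b a \<omega>))" for a \<omega>
  have F_carrier: "F a \<omega> \<in> carrier homeo_line" and F_proj: "homeo_proj (F a \<omega>) = \<tau> a \<omega>"
    if "a \<in> carrier G" "\<omega> \<in> space M" for a \<omega>
    unfolding F_def using euler_section(1,2)[OF tau_carrier[OF that]]
    by (auto intro: homeo_line_translate simp: homeo_proj_translate simp del: of_int_minus)
  have F_meas: "F a \<in> M \<rightarrow>\<^sub>M borel_homeo_line" if a: "a \<in> carrier G" for a
  proof (rule measurable_homeo_lineI)
    have [measurable]: "b a \<in> M \<rightarrow>\<^sub>M count_space UNIV" using a b by simp
    have [measurable]: "(\<lambda>\<omega>. euler_section (\<tau> a \<omega>) x) \<in> borel_measurable M" for x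
      using a by (intro measurable_homeo_line_apply_const
          measurable_compose[OF tau_measurable euler_section_measurable])
    show "(\<lambda>\<omega>. F a \<omega> x) \<in> borel_measurable M" for x unfolding F_def by measurable
  qed (use a F_carrier in auto)
  have F_mult: "AE \<omega> in M. F (a \<otimes> c) \<omega> = F a \<omega> \<otimes>\<^bsub>homeo_line\<^esub> F c (act (inv a) \<omega>)"
    if a: "a \<in> carrier G" and c: "c \<in> carrier G" for a c
    using eul[OF a c] tau_mult[OF a c] AE_space
  proof eventually_elim
    case (elim \<omega>)
    let ?\<omega> = "act (inv a) \<omega>"
    have \<omega>: "?\<omega> \<in> space M" using a elim(3) act_space by simp
    have carrier: "\<tau> a \<omega> \<in> carrier homeo_circle" "\<tau> c ?\<omega> \<in> carrier homeo_circle"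
      using a c elim(3) \<omega> by (auto intro!: tau_carrier)
    have "F (a \<otimes> c) \<omega> x = F a \<omega> (F c ?\<omega> x)" for x
    proof -
      have "F a \<omega> (F c ?\<omega> x) = euler_section (\<tau> a \<omega>) (euler_section (\<tau> c ?\<omega>) x)
          - b c ?\<omega> - b a \<omega>"
        using homeo_lineD(4)[OF euler_section(1)[OF carrier(1)], of _ "- b c ?\<omega>"] by (simp add: F_def)
      also have "\<dots> = euler_section (\<tau> (a \<otimes> c) \<omega>) x - b (a \<otimes> c) \<omega>"
        using euler_cocycle_eq[OF carrier, of x] unfolding elim(1,2) by simp
      finally show ?thesis by (simp add: F_def)
    qed
    then show ?case
      using homeo_line_mult[OF F_carrier[OF a elim(3)] F_carrier[OF c \<omega>]] by auto
  qed
  \<comment> \<open>Since \<open>F\<close> lifts \<open>\<tau>\<close>, inverting it at the inverse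
    element gives a lift of \<open>\<sigma>\<close>.\<close>
  define \<sigma>' where "\<sigma>' = (\<lambda>(a, \<omega>). inv\<^bsub>homeo_line\<^esub> F (inv a) \<omega>)"
  have "line_cocycle G M act \<sigma>'"
    unfolding measurable_cocycle_def
  proof (intro conjI ballI)
    \<comment> \<open>Countability of the group reduces joint measurability to measurability for
      each fixed group element.\<close>
    show "\<sigma>' \<in> count_space (carrier G) \<Otimes>\<^sub>M M \<rightarrow>\<^sub>M borel_homeo_line"
      unfolding \<sigma>'_def
      by (rule measurable_pair_measure_countable1[OF countable])
        (simp add: homeo_line_inv_measurable F_meas)
    fix a c assume a: "a \<in> carrier G" and c: "c \<in> carrier G"
    show "AE \<omega> in M. \<sigma>' (a \<otimes> c, \<omega>) = \<sigma>' (a, act c \<omega>) \<otimes>\<^bsub>homeo_line\<^esub> \<sigma>' (c, \<omega>)"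
      using F_mult[OF inv_closed[OF c] inv_closed[OF a]] AE_space
    proof eventually_elim
      case (elim \<omega>)
      have "F (inv c) \<omega> \<in> carrier homeo_line" "F (inv a) (act c \<omega>) \<in> carrier homeo_line"
        using a c elim(2) by (auto intro!: F_carrier act_space)
      then show ?case using elim(1) a c by (simp add: \<sigma>'_def inv_mult_group homeo_line.inv_mult_group)
    qed
  qed
  moreover have "lift_of_cocycle G M \<sigma>' \<sigma>"
    unfolding lift_of_cocycle_def
  proof (intro ballI AE_I2)
    fix a \<omega> assume a: "a \<in> carrier G" and \<omega>: "\<omega> \<in> space M"
    have "homeo_proj (\<sigma>' (a, \<omega>)) = inv\<^bsub>homeo_circle\<^esub> \<tau> (inv a) \<omega>"
      using group_hom.hom_inv[OF homeo_proj_hom F_carrier[OF inv_closed[OF a] \<omega>]] a \<omega>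
      by (simp add: \<sigma>'_def F_proj)
    then show "homeo_proj (\<sigma>' (a, \<omega>)) = \<sigma> (a, \<omega>)"
      using a \<omega> sigma_carrier by (simp add: \<tau>_def)
  qed
  \<comment> \<open>\<open>C\<close> bounds the primitive and the extra 1 accounts for the section
    at 0, so almost surely all values \<open>F a \<omega> 0\<close> lie in [-D, D]. Truncating to
    this interval changes \<open>r\<close> only on a null set, but makes the supremum exist and stay
    in the interval for every \<open>\<omega>\<close>.\<close>
  moreover define D where "D = \<bar>C\<bar> + 1"
  define r where "r \<omega> = (SUP a\<in>carrier G. max (- D) (min D (F a \<omega> 0)))" for \<omega>
  have D: "0 \<le> D" by (simp add: D_def)
  have clamp: "max (- D) (min D x) \<in> {- D..D}" for x using D by auto
  have "equivariant_family G M act borel \<sigma>' r"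
    unfolding equivariant_family_def
  proof (intro conjI ballI)
    have "(\<lambda>\<omega>. max (- D) (min D (F a \<omega> 0))) \<in> borel_measurable M" if "a \<in> carrier G" for a
      using measurable_homeo_line_apply_const[OF F_meas[OF that]] by simp
    then show "r \<in> borel_measurable M"
      unfolding r_def[abs_def] using clamp
      by (intro borel_measurable_cSUP[OF countable]) (auto intro!: bdd_aboveI2[of _ _ D])
    fix a assume a: "a \<in> carrier G"
    have "AE \<omega> in M. \<bar>F c \<omega> 0\<bar> \<le> D" if c: "c \<in> carrier G" for c
      using C[OF c] AE_space
    proof eventually_elim
      case (elim \<omega>)
      then show ?case using euler_section(3,4)[OF tau_carrier[OF c elim(2)]] by (simp add: F_def D_def)
    qed
    \<comment> \<open>Countability merges the exceptional sets of the single group elements into one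
      null set, off which the truncation has no effect.\<close>
    then have D_le: "AE \<omega> in M. \<forall>c\<in>carrier G. \<bar>F c \<omega> 0\<bar> \<le> D"
      by (simp add: AE_ball_countable[OF countable])
    have "AE \<omega> in M. \<forall>c\<in>carrier G. F (inv a \<otimes> c) \<omega> = F (inv a) \<omega> \<otimes>\<^bsub>homeo_line\<^esub> F c (act (inv (inv a)) \<omega>)"
      using F_mult[OF inv_closed[OF a]] by (simp add: AE_ball_countable[OF countable])
    then show "AE \<omega> in M. r (act a \<omega>) = \<sigma>' (a, \<omega>) (r \<omega>)"
      using D_le AE_act[OF a D_le] AE_space
    proof eventually_elim
      case (elim \<omega>)
      let ?\<omega> = "act a \<omega>" and ?F = "F (inv a) \<omega>"
      have \<omega>: "?\<omega> \<in> space M" using a elim(4) act_space by simp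
      have r_eq: "r \<omega>' = (SUP c\<in>carrier G. F c \<omega>' 0)" if "\<forall>c\<in>carrier G. \<bar>F c \<omega>' 0\<bar> \<le> D" for \<omega>'
        unfolding r_def using that by (intro SUP_cong) (auto simp: abs_le_iff min_def max_def)
      have F: "?F \<in> carrier homeo_line" using F_carrier a elim(4) by simp
      have "?F (r ?\<omega>) = ?F (Sup ((\<lambda>c. F c ?\<omega> 0) ` carrier G))" by (simp add: r_eq[OF elim(3)])
      \<comment> \<open>An increasing continuous map commutes with the supremum of a nonempty set
        that is bounded above.\<close>
      also have "\<dots> = Sup (?F ` (\<lambda>c. F c ?\<omega> 0) ` carrier G)"
      proof (rule continuous_at_Sup_mono)
        show "mono ?F" using homeo_line_le_iff[OF F] by (simp add: mono_def)
        show "continuous (at_left (Sup ((\<lambda>c. F c ?\<omega> 0) ` carrier G))) ?F"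
          using homeo_lineD(1)[OF F, of UNIV]
          by (simp add: continuous_on_eq_continuous_within continuous_at_imp_continuous_at_within)
        show "bdd_above ((\<lambda>c. F c ?\<omega> 0) ` carrier G)"
          using elim(3) by (intro bdd_aboveI2[of _ _ D]) (auto simp: abs_le_iff)
      qed auto
      \<comment> \<open>By the cocycle identity \<open>?F\<close> carries the orbit values over the
        translated point to those over \<open>\<omega>\<close>, reindexed by left multiplication
        with the inverse of \<open>a\<close>. This is a bijection of the group, so the supremum
        becomes \<open>r \<omega>\<close>.\<close>
      also have "?F ` (\<lambda>c. F c ?\<omega> 0) ` carrier G = (\<lambda>c. F (inv a \<otimes> c) \<omega> 0) ` carrier G"
        unfolding image_image
      proof (rule image_cong)
        fix c assume c: "c \<in> carrier G"
        show "?F (F c ?\<omega> 0) = F (inv a \<otimes> c) \<omega> 0"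
          using elim(1) c a homeo_line_mult[OF F F_carrier[OF c \<omega>]] by simp
      qed simp
      also have "\<dots> = (\<lambda>c. F c \<omega> 0) ` (\<lambda>c. inv a \<otimes> c) ` carrier G" by (simp add: image_image)
      also have "(\<lambda>c. inv a \<otimes> c) ` carrier G = carrier G"
        using a by (simp add: surj_const_mult)
      also have "Sup ((\<lambda>c. F c \<omega> 0) ` carrier G) = r \<omega>" by (simp add: r_eq[OF elim(2)])
      finally have "?F (r ?\<omega>) = r \<omega>" .
      then show ?case using homeo_line_inv_eq(2)[OF F, of "r ?\<omega>"] by (simp add: \<sigma>'_def)
    qed
  qed
  moreover have "r \<omega> \<in> {- D..D}" for \<omega>
  proof -
    have "r \<omega> \<le> D" unfolding r_def using clamp by (intro cSUP_least) auto
    moreover have "- D \<le> r \<omega>"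
      unfolding r_def using clamp by (intro cSUP_upper2[of _ _ \<one>]) (auto intro!: bdd_aboveI2[of _ _ D])
    ultimately show ?thesis by simp
  qed
  then have "bounded (essential_image M r)"
    by (intro bounded_essential_image[of "{- D..D}"]) auto
  ultimately show ?thesis by blast
qed

text \<open>A constant map absorbs the trivial cocycle, so an equivariant family intertwines as a
  family of constants. Conversely, the trivial cocycle fixes the base point 1, and the images of 1
  under a semicohomology form an equivariant family.\<close>

lemma equivariant_circle_family_iff_semicohomologous:
  "(\<exists>r. equivariant_family G M act circle_borel \<sigma> r) \<longleftrightarrow> semicohomologous G M act \<sigma> trivial_cocycle"
proof
  assume "\<exists>r. equivariant_family G M act circle_borel \<sigma> r"
  then obtain r where "equivariant_family G M act circle_borel \<sigma> r" ..
  then have r: "r \<in> M \<rightarrow>\<^sub>M circle_borel"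
    and eq: "\<And>a. a \<in> carrier G \<Longrightarrow> AE \<omega> in M. r (act a \<omega>) = \<sigma> (a, \<omega>) (r \<omega>)"
    by (simp_all add: equivariant_family_def)
  have r_circle: "r \<omega> \<in> circle" if "\<omega> \<in> space M" for \<omega>
    using measurable_space[OF r that] by (simp add: space_restrict_space)
  have "left_semicohomologous G M act \<sigma> trivial_cocycle"
    unfolding left_semicohomologous_def
  proof (intro exI[of _ "\<lambda>(z, \<omega>). r \<omega>"] conjI ballI)
    show "(\<lambda>(z, \<omega>). r \<omega>) \<in> circle_borel \<Otimes>\<^sub>M M \<rightarrow>\<^sub>M circle_borel"
      unfolding case_prod_beta by (rule measurable_compose[OF measurable_snd r])
    show "AE \<omega> in M. nondecreasing_degree_one (\<lambda>z. case (z, \<omega>) of (z, \<omega>) \<Rightarrow> r \<omega>)"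
      using nondecreasing_degree_one_const r_circle by (intro AE_I2) simp
    fix a assume "a \<in> carrier G"
    from eq[OF this] show "AE \<omega> in M. \<forall>z\<in>circle. \<sigma> (a, \<omega>) (case (z, \<omega>) of (z, \<omega>) \<Rightarrow> r \<omega>)
        = (case (trivial_cocycle (a, \<omega>) z, act a \<omega>) of (z, \<omega>) \<Rightarrow> r \<omega>)"
      by eventually_elim simp
  qed
  \<comment> \<open>This direction is witnessed by the constant map to 1, which the identity fixes
    and which ignores whatever \<open>\<sigma>\<close> does to its argument.\<close>
  moreover have "left_semicohomologous G M act trivial_cocycle \<sigma>"
    unfolding left_semicohomologous_def
  proof (intro exI[of _ "\<lambda>_. 1"] conjI ballI)
    show "AE \<omega> in M. nondecreasing_degree_one (\<lambda>z. 1)"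
      by (intro AE_I2 nondecreasing_degree_one_const) simp
  qed (auto simp: trivial_cocycle_def homeo_circle_one space_restrict_space)
  ultimately show "semicohomologous G M act \<sigma> trivial_cocycle"
    by (simp add: semicohomologous_def right_semicohomologous_def)
next
  assume "semicohomologous G M act \<sigma> trivial_cocycle"
  then obtain \<phi> where \<phi>: "\<phi> \<in> circle_borel \<Otimes>\<^sub>M M \<rightarrow>\<^sub>M circle_borel"
    and eq: "\<And>a. a \<in> carrier G \<Longrightarrow> AE \<omega> in M. \<forall>z\<in>circle.
      \<sigma> (a, \<omega>) (\<phi> (z, \<omega>)) = \<phi> (trivial_cocycle (a, \<omega>) z, act a \<omega>)"
    unfolding semicohomologous_def left_semicohomologous_def by blast
  have "equivariant_family G M act circle_borel \<sigma> (\<lambda>\<omega>. \<phi> (1, \<omega>))"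
    unfolding equivariant_family_def
  proof (intro conjI ballI)
    show "(\<lambda>\<omega>. \<phi> (1, \<omega>)) \<in> M \<rightarrow>\<^sub>M circle_borel"
      by (intro measurable_compose[OF measurable_Pair1' \<phi>]) (simp add: space_restrict_space)
    fix a assume "a \<in> carrier G"
    from eq[OF this] show "AE \<omega> in M. \<phi> (1, act a \<omega>) = \<sigma> (a, \<omega>) (\<phi> (1, \<omega>))"
    proof eventually_elim
      case (elim \<omega>)
      have "(1::complex) \<in> circle" by simp
      with elim show ?case by (simp add: trivial_cocycle_def homeo_circle_one)
    qed
  qed
  then show "\<exists>r. equivariant_family G M act circle_borel \<sigma> r" by blast
qed

end

theorem theorem4p6:
  fixes G :: "('g, 'm) monoid_scheme"
    and M :: "'w measure"
    and act :: "'g \<Rightarrow> 'w \<Rightarrow> 'w"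
    and \<sigma> :: "'g \<times> 'w \<Rightarrow> (complex \<Rightarrow> complex)"
  assumes "group G"
    and "finitely_generated G"
    and "standard_borel_prob_space_action G M act"
    and "circle_cocycle G M act \<sigma>"
  shows
    "(parametrized_euler_class G M act \<sigma> = \<one>\<^bsub>bounded_cohomology 2 G (Linf_int_module G M act)\<^esub>
      \<longleftrightarrow> (\<exists>\<sigma>'. line_cocycle G M act \<sigma>' \<and> lift_of_cocycle G M \<sigma>' \<sigma> \<and>
             (\<exists>r. equivariant_family G M act borel \<sigma>' r \<and> bounded (essential_image M r))))
   \<and> ((\<exists>\<sigma>'. line_cocycle G M act \<sigma>' \<and> lift_of_cocycle G M \<sigma>' \<sigma> \<and>
             (\<exists>r. equivariant_family G M act borel \<sigma>' r \<and> bounded (essential_image M r)))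
      \<longleftrightarrow> (\<exists>r. equivariant_family G M act circle_borel \<sigma> r))
   \<and> ((\<exists>r. equivariant_family G M act circle_borel \<sigma> r)
      \<longleftrightarrow> semicohomologous G M act \<sigma> trivial_cocycle)"
proof -
  interpret circle_cocycle_action G M act \<sigma>
    using assms by (intro circle_cocycle_action.intro prob_space_action.intro
        prob_space_action_axioms.intro circle_cocycle_action_axioms.intro)
  show ?thesis
    \<comment> \<open>The first three conditions are linked in a cycle through (1), (2), (3) and
      back to (1); the fourth is attached to (3).\<close>
    using vanishing_imp_bounded_lift[OF assms(2)] equivariant_line_family_imp_circle
      equivariant_circle_family_imp_vanishing equivariant_circle_family_iff_semicohomologous
    by blast
qed

end
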